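(* For integers $n$ and $\Delta$, let $\lambda_1(n,\Delta)$ denote the maximum of $\lambda_1(G)$ over all connected nonregular graphs $G$ on $n$ vertices with maximum degree $\Delta$. Then \[ \lim_{n\to\infty} n^2 (3 - \lambda_1(n,3)) = \frac{\pi^2}{2} \qquad\text{and}\qquad \lim_{n\to\infty} n^2 (4 - \lambda_1(n,4)) = \pi^2. \]
   Context: All graphs are finite, simple and undirected. $\lambda_1(G)$ denotes the largest eigenvalue (spectral radius) of the adjacency matrix of $G$. A graph is nonregular if not all its vertices have the same degree. *)

theory Defs
  imports
    Complex_Main
    "Jordan_Normal_Form.Char_Poly"
    "Graph_Theory.Graph_Theory"
begin

text \<open>
  A finite simple undirected graph is a \<^const>\<open>pair_graph\<close>: a finite, loop-free, symmetric set of
  ordered pairs on a finite vertex set, each undirected edge being represented by its two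
  orientations. Hence \<^const>\<open>out_degree\<close> is the usual vertex degree.
\<close>

definition max_degree :: "'a pair_pre_digraph \<Rightarrow> nat" where
  "max_degree G = Max (out_degree (with_proj G) ` pverts G)"

definition regular_graph :: "'a pair_pre_digraph \<Rightarrow> bool" where
  "regular_graph G \<longleftrightarrow>
     (\<forall>u \<in> pverts G. \<forall>v \<in> pverts G. out_degree (with_proj G) u = out_degree (with_proj G) v)"

text \<open>
  The rows and columns are indexed by the vertices themselves, so this is meant for graphs with
  vertex set \<open>{..<n}\<close> only.
\<close>

definition adjacency_matrix :: "nat pair_pre_digraph \<Rightarrow> real mat" where
  "adjacency_matrix G =
     mat (card (pverts G)) (card (pverts G)) (\<lambda>(i, j). if (i, j) \<in> parcs G then 1 else 0)"

definition lambda1 :: "nat pair_pre_digraph \<Rightarrow> real" where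
  "lambda1 G = Max {k. eigenvalue (adjacency_matrix G) k}"

text \<open>
  Every graph on \<open>n\<close> vertices is isomorphic to one with vertex set \<open>{..<n}\<close>, and all notions
  involved are invariant under isomorphism, so it suffices to range over the latter.
\<close>

definition nonregular_graphs :: "nat \<Rightarrow> nat \<Rightarrow> nat pair_pre_digraph set" where
  "nonregular_graphs n \<Delta> =
     {G. pair_graph G \<and> pverts G = {..<n} \<and> Digraph_Component.connected (with_proj G) \<and>
         \<not> regular_graph G \<and> max_degree G = \<Delta>}"

text \<open>
  The maximum is over a finite set; it is unspecified when no such graph exists, which for
  \<open>\<Delta> \<ge> 3\<close> happens only for \<open>n \<le> \<Delta>\<close>.
\<close>

definition max_lambda1 :: "nat \<Rightarrow> nat \<Rightarrow> real" where
  "max_lambda1 n \<Delta> = Max (lambda1 ` nonregular_graphs n \<Delta>)"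

end

theory Submission
  imports Defs "HOL-Analysis.Function_Topology" "HOL-Real_Asymp.Real_Asymp"
    "Jordan_Normal_Form.Spectral_Radius"
begin

text \<open>
  Write \<open>\<mu> = \<Delta> - \<lambda>\<^sub>1\<close> and list the entries of a Perron vector in decreasing order
  \<open>f 0 \<ge> f 1 \<ge> \<dots>\<close>. Summing the eigenvalue equation over the first \<open>k\<close> vertices shows that
  the total drop of the vector over the edges leaving them is at most \<open>\<mu> (f 0 + \<dots> + f (k - 1))\<close>.
  As long as the vertices have full degree \<open>\<Delta>\<close>, parity and the absence of parallel edges
  prevent consecutive cuts from being small too often, so over \<open>m\<close> consecutive vertices \<open>f\<close> drops by
  at most \<open>r m + O(1)\<close> times that flow, with \<open>r = 1/2\<close> for \<open>\<Delta> = 3\<close> and \<open>r = 1/4\<close> for \<open>\<Delta> = 4\<close>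
  (\<open>r\<close> is an effective resistance per vertex). At the first vertex of smaller degree \<open>f\<close> is
  almost zero. The partial sums \<open>F\<close> therefore satisfy a discrete form of
  \<open>F'' \<ge> - \<mu> r F\<close>, \<open>F 0 = 0\<close>, \<open>F' n \<approx> 0\<close>, and testing with a quarter period of the sine gives
  \<open>\<mu> r \<ge> (\<pi> / (2 n))\<^sup>2 (1 - o(1))\<close>.

  For the converse, chains of copies of \<open>K\<^sub>4\<close> minus an edge joined by bridges (\<open>\<Delta> = 3\<close>), and chains of copies
  of \<open>K\<^sub>4\<close> joined through cut vertices (\<open>\<Delta> = 4\<close>), attain the resistance \<open>r\<close> per vertex; a
  quarter period of the cosine along the chain is a test vector with matching Rayleigh quotient.
\<close>

section \<open>Gaps along edge cuts\<close>

text \<open>Abstracts the vertices \<open>0..N\<close>, listed by decreasing \<open>f\<close>: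
  \<open>a v\<close> and \<open>b v\<close> count earlier and later neighbours, \<open>c k\<close>
  the edges leaving the first \<open>k\<close> vertices, \<open>s v\<close> the edges passing over
  \<open>v\<close>. Simplicity of the graph enters through \<open>a_Suc\<close> and
  \<open>a_Suc2\<close>: besides edges passing over \<open>v\<close>, there is room for one edge
  from \<open>v\<close> to \<open>Suc v\<close>, and for three among \<open>v\<close> and its two
  successors. For \<open>k = 1\<close>, truncated subtraction turns the second term of
  \<open>flow\<close> into zero.\<close>

locale cut_profile =
  fixes N D :: nat and a b c s :: "nat \<Rightarrow> nat" and f :: "nat \<Rightarrow> real" and \<Phi> :: real
  assumes c_in: "v < N \<Longrightarrow> c v = s v + a v"
    and c_out: "v < N \<Longrightarrow> c (Suc v) = s v + b v"
    and deg: "v < N \<Longrightarrow> a v + b v = D"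
    and c_0: "c 0 = 0"
    and c_pos: "0 < k \<Longrightarrow> k \<le> N \<Longrightarrow> 0 < c k"
    and a_Suc: "Suc v < N \<Longrightarrow> a (Suc v) \<le> s v + 1"
    and a_Suc2: "Suc (Suc v) < N \<Longrightarrow> a (Suc v) + a (Suc (Suc v)) \<le> s v + 3"
    and antimono: "i \<le> j \<Longrightarrow> j \<le> N \<Longrightarrow> f j \<le> f i"
    and flow: "0 < k \<Longrightarrow> k < N \<Longrightarrow>
      c k * (f (k - 1) - f k) + s (k - 1) * (f (k - 2) - f (k - 1)) + s k * (f k - f (Suc k)) \<le> \<Phi>"
    and last_gap: "0 < N \<Longrightarrow> f (N - 1) - f N \<le> \<Phi>"
    and Phi_nonneg: "0 \<le> \<Phi>"
begin

text \<open>All three gaps are nonnegative, so the multiplicities may be lowered to whatever is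
  known about them.\<close>

lemma flow_weaken:
  assumes "0 < k" "k < N" "x \<le> c k" "y \<le> s (k - 1)" "z \<le> s k"
  shows "x * (f (k - 1) - f k) + y * (f (k - 2) - f (k - 1)) + z * (f k - f (Suc k)) \<le> \<Phi>"
proof -
  have "x * (f (k - 1) - f k) \<le> c k * (f (k - 1) - f k)"
    using assms antimono[of "k - 1" k] by (intro mult_right_mono) auto
  moreover have "y * (f (k - 2) - f (k - 1)) \<le> s (k - 1) * (f (k - 2) - f (k - 1))"
    using assms antimono[of "k - 2" "k - 1"] by (intro mult_right_mono) auto
  moreover have "z * (f k - f (Suc k)) \<le> s k * (f k - f (Suc k))"
    using assms antimono[of k "Suc k"] by (intro mult_right_mono) auto
  ultimately show ?thesis using flow[OF assms(1,2)] by linarith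
qed

lemma gap_le: "0 < k \<Longrightarrow> k \<le> N \<Longrightarrow> f (k - 1) - f k \<le> \<Phi>"
  using flow_weaken[of k 1 0 0] c_pos[of k] last_gap by (cases "k = N") auto

lemma drop_le: "u \<le> k \<Longrightarrow> k \<le> N \<Longrightarrow> f u - f k \<le> \<Phi> * (real k - real u)"
proof (induction k rule: dec_induct)
  case (step k)
  then show ?case using gap_le[of "Suc k"] by (simp add: algebra_simps)
qed simp

text \<open>An edge passing over \<open>v\<close> lies in both cuts next to \<open>v\<close>, an
  edge at \<open>v\<close> in exactly one. Lower bounds on \<open>s\<close> below come from
  this.\<close>

lemma cut_sum: "v < N \<Longrightarrow> c v + c (Suc v) = 2 * s v + D"
  using c_in[of v] c_out[of v] deg[of v] by simp

end

section \<open>Degree 3: resistance 1/2 per vertex\<close>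

locale cubic_cut_profile = cut_profile N 3 a b c s f \<Phi> for N a b c s f \<Phi>
begin

lemma cut_parity: "k \<le> N \<Longrightarrow> even (c k) \<longleftrightarrow> even k"
proof (induction k)
  case (Suc k)
  then show ?case using cut_sum[of k] by presburger
qed (simp add: c_0)

text \<open>With gaps g_k = f (k - 1) - f k, the left side is g_(i-1) + 2 g_i + g_(i+1). A single
  gap may use up all of \<Phi> at a bridge, but bridges occur only at odd positions; so sums over
  pairs are compared, and these fall at half the rate.\<close>

lemma pair_drop:
  assumes "even i" "2 \<le> i" "i < N"
  shows "f (i - 2) + f (i - 1) - (f i + f (Suc i)) \<le> 2 * \<Phi>"
proof -
  obtain v where v: "i = Suc v" "0 < v" using assms by (cases i) auto
  have parity: "even (c i)" "odd (c v)" "odd (c (Suc i))"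
    using assms v cut_parity[of i] cut_parity[of v] cut_parity[of "Suc i"] by auto
  have sums: "c v + c i = 2 * s v + 3" "c i + c (Suc i) = 2 * s i + 3"
    using cut_sum[of v] cut_sum[of i] assms v by auto
  have pos: "0 < c v" "0 < c i" "0 < c (Suc i)" using c_pos assms v by auto
  have gaps: "f (i - 2) - f (i - 1) \<le> \<Phi>" "f i - f (Suc i) \<le> \<Phi>"
    using gap_le[of v] gap_le[of "Suc i"] assms v by (auto simp: numeral_2_eq_2)
  have nn: "f (i - 2) - f (i - 1) \<ge> 0" "f (i - 1) - f i \<ge> 0" "f i - f (Suc i) \<ge> 0"
    using antimono[of "i-2" "i-1"] antimono[of "i-1" i] antimono[of i "Suc i"] assms by auto
  consider "c i \<ge> 4" | "c i = 2" "c v \<ge> 3" | "c i = 2" "c (Suc i) \<ge> 3" | "c i = 2" "c v = 1" "c (Suc i) = 1"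
  proof -
    have "c i = 2 \<or> 4 \<le> c i" "c v = 1 \<or> 3 \<le> c v" "c (Suc i) = 1 \<or> 3 \<le> c (Suc i)"
      using parity pos by presburger+
    then show ?thesis using that by blast
  qed
  then show ?thesis
  proof cases
    case 1
    then have "1 \<le> s v" "1 \<le> s i" using sums pos by auto
    then show ?thesis using flow_weaken[of i 4 1 1] 1 assms v nn by simp
  next
    case 2
    then have "1 \<le> s v" using sums by auto
    then show ?thesis using flow_weaken[of i 2 1 0] 2 assms v gaps by simp
  next
    case 3
    then have "1 \<le> s i" using sums by auto
    then show ?thesis using flow_weaken[of i 2 0 1] 3 assms v gaps by simp
  next
    case 4
    \<comment> \<open>Both edges of cut \<open>i\<close> would join \<open>v\<close> to
      \<open>i\<close>, a pair of parallel edges.\<close>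
    then have "s v = 0" "s i = 0" using sums by auto
    then have "a i = 2" using c_in[of i] assms 4 by simp
    then show ?thesis using a_Suc[of v] assms v \<open>s v = 0\<close> by simp
  qed
qed

lemma pair_drops: "p \<le> q \<Longrightarrow> 2 * q < N \<Longrightarrow>
  f (2 * p) + f (2 * p + 1) - (f (2 * q) + f (2 * q + 1)) \<le> 2 * \<Phi> * (real q - real p)"
proof (induction q rule: dec_induct)
  case (step q)
  then show ?case using pair_drop[of "2 * Suc q"] by (simp add: algebra_simps)
qed simp

text \<open>\<open>u\<close> is rounded up to \<open>2 * p\<close> and \<open>N\<close> down to the
  pair at \<open>2 * q\<close>; the few gaps lost at both ends cost at most \<Phi> each and go into
  the constant 4.\<close>

theorem drop_bound:
  assumes "u \<le> N"
  shows "f u - f N \<le> \<Phi> * ((real N - real u) / 2 + 4)"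
proof (cases "N \<le> u + 4")
  case True
  then have "f u - f N \<le> \<Phi> * (real N - real u)" using drop_le[of u N] assms by simp
  also have "\<dots> \<le> \<Phi> * ((real N - real u) / 2 + 4)"
    using of_nat_mono[OF True, where 'a = real] assms Phi_nonneg
    by (intro mult_left_mono) (auto simp: field_simps)
  finally show ?thesis .
next
  case False
  define p where "p = (u + 1) div 2"
  define q where "q = (N - 1) div 2"
  have pq: "u \<le> 2 * p" "2 * p \<le> u + 1" "2 * q < N" "N \<le> 2 * q + 2" "p \<le> q"
    using False unfolding p_def q_def by auto
  note P = Phi_nonneg
  have "f u - f (2 * p) \<le> \<Phi> * (real (2 * p) - real u)" using drop_le[of u "2 * p"] pq by simp
  also have "\<dots> \<le> \<Phi> * 1" using pq P by (intro mult_left_mono) linarith+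
  finally have 1: "f u - f (2 * p) \<le> \<Phi>" by simp
  have 2: "f (2 * p) - f (2 * p + 1) \<le> \<Phi>" using gap_le[of "2 * p + 1"] pq by simp
  have "f (2 * q) - f N \<le> \<Phi> * (real N - real (2 * q))" using drop_le[of "2 * q" N] pq by simp
  also have "\<dots> \<le> \<Phi> * 2" using pq P by (intro mult_left_mono) linarith+
  finally have 3: "f (2 * q) - f N \<le> \<Phi> * 2" .
  have 4: "f (2 * q + 1) \<le> f (2 * q)" using antimono[of "2 * q" "2 * q + 1"] pq by simp
  have 5: "f (2 * p) + f (2 * p + 1) - (f (2 * q) + f (2 * q + 1)) \<le> 2 * \<Phi> * (real q - real p)"
    using pair_drops[of p q] pq by simp
  have "f u - f N \<le> \<Phi> * (real q - real p) + 4 * \<Phi>" using 1 2 3 4 5 P by linarith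
  also have "\<dots> = \<Phi> * (real q - real p + 4)" by (simp add: algebra_simps)
  also have "\<dots> \<le> \<Phi> * ((real N - real u) / 2 + 4)"
    using pq P by (intro mult_left_mono) (auto simp: field_simps)
  finally show ?thesis .
qed

end

section \<open>Degree 4: resistance 1/4 per vertex\<close>

locale quartic_cut_profile = cut_profile N 4 a b c s f \<Phi> for N a b c s f \<Phi>
begin

lemma cut_even: "k \<le> N \<Longrightarrow> even (c k)"
proof (induction k)
  case (Suc k)
  then show ?case using cut_sum[of k] by presburger
qed (simp add: c_0)

lemma cut_cases:
  assumes "0 < k" "k \<le> N"
  shows "c k = 2 \<or> 4 \<le> c k"
  using cut_even[of k] c_pos[of k] assms by presburger

text \<open>Two or three consecutive vertices of degree 4 span at most one or three edges, so at
  least 6 edges leave them, while two cuts of size 2 admit only 4. By this and the next two lemmas,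
  cuts of size 2 come singly or in adjacent pairs, and at least three larger cuts separate such
  groups.\<close>

lemma no_three_small_cuts:
  assumes "c k = 2" "c (Suc k) = 2" "c (Suc (Suc k)) = 2" "Suc k < N"
  shows False
  using a_Suc[of k] c_in[of "Suc k"] cut_sum[of k] cut_sum[of "Suc k"] assms by simp

lemma no_small_big_small:
  assumes "c k = 2" "4 \<le> c (Suc k)" "c (Suc (Suc k)) = 2" "Suc k < N"
  shows False
  using a_Suc[of k] c_in[of "Suc k"] cut_sum[of k] cut_sum[of "Suc k"] assms by simp

lemma no_small_big_big_small:
  assumes "c k = 2" "4 \<le> c (Suc k)" "4 \<le> c (Suc (Suc k))" "c (Suc (Suc (Suc k))) = 2"
    and "Suc (Suc k) < N"
  shows False
  using a_Suc2[of k] c_in[of "Suc k"] c_in[of "Suc (Suc k)"] 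
    cut_sum[of k] cut_sum[of "Suc k"] cut_sum[of "Suc (Suc k)"] assms by simp

text \<open>With a cut of size 2 just before \<open>k\<close>, half of the last gap is not yet accounted for.\<close>

definition partial_drop :: "nat \<Rightarrow> nat \<Rightarrow> real" where
  "partial_drop u k = (if c (k - 1) = 2 then f u - (f (k - 1) + f k) / 2 else f u - f k)"

lemma gap_half: "0 < k \<Longrightarrow> k < N \<Longrightarrow> 2 * (f (k - 1) - f k) \<le> \<Phi>"
  using flow_weaken[of k 2 0 0] cut_cases[of k] by fastforce

lemma drop_half: "u \<le> k \<Longrightarrow> k < N \<Longrightarrow> f u - f k \<le> \<Phi> * ((real k - real u) / 2)"
proof (induction k rule: dec_induct)
  case (step k)
  then show ?case using gap_half[of "Suc k"] by (simp add: algebra_simps)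
qed simp

text \<open>Three large cuts force two edges to pass over each of \<open>w\<close> and
  \<open>Suc w\<close>, so the flow through the middle cut pays for its own gap and for half of each
  neighbouring gap at a cost of \<Phi> / 4. This repays the half gap withheld at \<open>w\<close>
  and reaches the middle of the gap after \<open>Suc w\<close>.\<close>

lemma drop_before_small:
  assumes IH: "partial_drop u w \<le> \<Phi> * ((real w - real u) / 4 + 3)"
    and big: "4 \<le> c w" "4 \<le> c (Suc w)" "4 \<le> c (Suc (Suc w))"
    and w: "0 < w" "Suc (Suc w) < N"
  shows "f u - (f (Suc w) + f (Suc (Suc w))) / 2 \<le> \<Phi> * ((real w - real u) / 4 + 3) + \<Phi> / 4"
proof -
  have s: "2 \<le> s w" "2 \<le> s (Suc w)"
    using cut_sum[of w] cut_sum[of "Suc w"] big w by auto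
  have fl: "4 * (f w - f (Suc w)) + 2 * (f (w - 1) - f w) + 2 * (f (Suc w) - f (Suc (Suc w))) \<le> \<Phi>"
    using flow_weaken[of "Suc w" 4 2 2] s big w by simp
  moreover have "f w \<le> f (w - 1)" using antimono[of "w - 1" w] w by simp
  ultimately show ?thesis using IH unfolding partial_drop_def by (auto simp: field_simps split: if_splits)
qed

text \<open>The induction goes from a large cut back to an earlier large cut, across a whole group
  of small ones, at a cost of at most \<Phi> / 4 per vertex: 1 vertex if the previous cut is large,
  4 vertices (cost 3/4 \<Phi>) for a single small cut, 5 vertices (cost 5/4 \<Phi>) for a pair. The
  pair is the tight case, realised by the chain of copies of K_4.\<close>

lemma partial_drop_bound:
  "u < k \<Longrightarrow> k < N \<Longrightarrow> 4 \<le> c k \<Longrightarrow> partial_drop u k \<le> \<Phi> * ((real k - real u) / 4 + 3)"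
proof (induction k rule: less_induct)
  case (less k)
  note P = Phi_nonneg
  show ?case
  \<comment> \<open>Steps go back by at most 5, so past \<open>u + 6\<close> they stay above
    \<open>u\<close>. On shorter stretches the constant 3 covers the weaker rate 1/2.\<close>
  proof (cases "k \<le> u + 6")
    case True
    have "partial_drop u k \<le> f u - f k"
      using antimono[of "k - 1" k] less unfolding partial_drop_def by auto
    also have "\<dots> \<le> \<Phi> * ((real k - real u) / 2)" using drop_half[of u k] less.prems by simp
    also have "\<dots> \<le> \<Phi> * ((real k - real u) / 4 + 3)"
      using of_nat_mono[OF True, where 'a = real] P
      by (intro mult_left_mono) (auto simp: field_simps)
    finally show ?thesis .
  next
    case False
    define j where "j = k - 6"
    have k: "k = Suc (Suc (Suc (Suc (Suc (Suc j)))))" and j: "u < j" using False by (auto simp: j_def)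
    consider (small) "c (k - 1) = 2" | (big) "4 \<le> c (k - 1)"
      using cut_cases[of "k - 1"] k less.prems by auto
    then show ?thesis
    proof cases
      case big
      have s: "2 \<le> s (k - 1)" using cut_sum[of "k - 1"] less.prems big k by simp
      \<comment> \<open>A quarter of this pays for the gap at \<open>k\<close> and for the half gap
        that \<open>partial_drop\<close> may have withheld at \<open>k - 1\<close>.\<close>
      have fl: "4 * (f (k - 1) - f k) + 2 * (f (k - 2) - f (k - 1)) \<le> \<Phi>"
        using flow_weaken[of k 4 2 0] s less.prems by simp
      have IH: "partial_drop u (k - 1) \<le> \<Phi> * ((real (k - 1) - real u) / 4 + 3)"
        using less.IH[of "k - 1"] big less.prems j k by simp
      have "f (k - 1) \<le> f (k - 2)" using antimono[of "k - 2" "k - 1"] less.prems by simp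
      moreover have "real (k - 1) = real k - 1" using k by simp
      ultimately show ?thesis using fl IH big k unfolding partial_drop_def
        by (auto simp: field_simps split: if_splits)
    next
      case small
      note c1 = small
      consider (small) "c (k - 2) = 2" | (big) "4 \<le> c (k - 2)"
        using cut_cases[of "k - 2"] k less.prems by auto
      then show ?thesis
      proof cases
        case small
        have big: "4 \<le> c (k - 3)" "4 \<le> c (k - 4)" "4 \<le> c (k - 5)"
        proof -
          show b3: "4 \<le> c (k - 3)"
            using cut_cases[of "k - 3"] no_three_small_cuts[of "k - 3"] small c1 k less.prems by auto
          show b4: "4 \<le> c (k - 4)"
            using cut_cases[of "k - 4"] no_small_big_small[of "k - 4"] small b3 k less.prems by auto
          show "4 \<le> c (k - 5)"
            using cut_cases[of "k - 5"] no_small_big_big_small[of "k - 5"] small b3 b4 k less.prems by auto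
        qed
        have IH: "partial_drop u (k - 5) \<le> \<Phi> * ((real (k - 5) - real u) / 4 + 3)"
          using less.IH[of "k - 5"] big less.prems j k by simp
        have B: "f u - (f (k - 4) + f (k - 3)) / 2 \<le> \<Phi> * ((real (k - 5) - real u) / 4 + 3) + \<Phi> / 4"
          using drop_before_small[OF IH] big less.prems k by simp
        have s: "1 \<le> s (k - 3)" "1 \<le> s (k - 1)"
          using cut_sum[of "k - 3"] cut_sum[of "k - 1"] less.prems small c1 big k by auto
        \<comment> \<open>Half the sum of this and the next estimate is exactly the drop from the
          midpoint of \<open>f (k - 4)\<close>, \<open>f (k - 3)\<close> to that of
          \<open>f (k - 1)\<close>, \<open>f k\<close>.\<close>
        have "2 * (f (k - 3) - f (k - 2)) + (f (k - 4) - f (k - 3)) \<le> \<Phi>"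
          using flow_weaken[of "k - 2" 2 1 0] s small less.prems k by simp
        moreover have "2 * (f (k - 2) - f (k - 1)) + (f (k - 1) - f k) \<le> \<Phi>"
          using flow_weaken[of "k - 1" 2 0 1] s c1 less.prems k by simp
        moreover have "real (k - 5) = real k - 5" using k by simp
        ultimately show ?thesis using B c1 unfolding partial_drop_def by (simp add: field_simps)
      next
        case big
        note big2 = big
        have big: "4 \<le> c (k - 3)" "4 \<le> c (k - 4)"
        proof -
          show b3: "4 \<le> c (k - 3)"
            using cut_cases[of "k - 3"] no_small_big_small[of "k - 3"] big2 c1 k less.prems by auto
          show b4: "4 \<le> c (k - 4)"
            using cut_cases[of "k - 4"] no_small_big_big_small[of "k - 4"] big2 c1 b3 k less.prems by auto
        qed
        have IH: "partial_drop u (k - 4) \<le> \<Phi> * ((real (k - 4) - real u) / 4 + 3)"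
          using less.IH[of "k - 4"] big less.prems j k by simp
        have B: "f u - (f (k - 3) + f (k - 2)) / 2 \<le> \<Phi> * ((real (k - 4) - real u) / 4 + 3) + \<Phi> / 4"
          using drop_before_small[OF IH] big big2 less.prems k by simp
        have s: "1 \<le> s (k - 2)" "1 \<le> s (k - 1)"
          using cut_sum[of "k - 2"] cut_sum[of "k - 1"] less.prems big2 c1 big k by auto
        have "2 * (f (k - 2) - f (k - 1)) + (f (k - 3) - f (k - 2)) + (f (k - 1) - f k) \<le> \<Phi>"
          using flow_weaken[of "k - 1" 2 1 1] s c1 less.prems k by simp
        moreover have "real (k - 4) = real k - 4" using k by simp
        ultimately show ?thesis using B c1 P unfolding partial_drop_def by (simp add: field_simps)
      qed
    qed
  qed
qed

text \<open>One of three consecutive cuts just before \<open>N\<close> is large, and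
  \<open>partial_drop_bound\<close> applies there; the at most four gaps after it and the withheld
  half gap are absorbed by the constant 7.\<close>

theorem drop_bound:
  assumes "u \<le> N"
  shows "f u - f N \<le> \<Phi> * ((real N - real u) / 4 + 7)"
proof (cases "N \<le> u + 4")
  case True
  then have "f u - f N \<le> \<Phi> * (real N - real u)" using drop_le[of u N] assms by simp
  also have "\<dots> \<le> \<Phi> * ((real N - real u) / 4 + 7)"
    using of_nat_mono[OF True, where 'a = real] assms Phi_nonneg
    by (intro mult_left_mono) (auto simp: field_simps)
  finally show ?thesis .
next
  case False
  define j where "j = N - 4"
  have N: "N = Suc (Suc (Suc (Suc j)))" and j: "u < j" using False by (auto simp: j_def)
  note P = Phi_nonneg
  obtain k where k: "j \<le> k" "k < N" "4 \<le> c k"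
  proof -
    have "\<not> (c j = 2 \<and> c (Suc j) = 2 \<and> c (Suc (Suc j)) = 2)"
      using no_three_small_cuts[of j] N by auto
    then show ?thesis
      using cut_cases[of j] cut_cases[of "Suc j"] cut_cases[of "Suc (Suc j)"] N j
        that[of j] that[of "Suc j"] that[of "Suc (Suc j)"] by auto
  qed
  have D: "f u - (f (k - 1) + f k) / 2 \<le> \<Phi> * ((real k - real u) / 4 + 3)"
  proof -
    have "f k \<le> f (k - 1)" using antimono[of "k - 1" k] k by simp
    then have "f u - (f (k - 1) + f k) / 2 \<le> partial_drop u k" unfolding partial_drop_def by simp
    also have "\<dots> \<le> \<Phi> * ((real k - real u) / 4 + 3)" using partial_drop_bound[of u k] k j by simp
    finally show ?thesis .
  qed
  have G: "f (k - 1) - f k \<le> \<Phi>" using gap_le[of k] k j by simp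
  have "f k - f N \<le> \<Phi> * (real N - real k)" using drop_le[of k N] k by simp
  also have "\<dots> \<le> \<Phi> * (3 + (real N - real k) / 4)" using P k N by (intro mult_left_mono) auto
  finally have E: "f k - f N \<le> \<Phi> * (3 + (real N - real k) / 4)" .
  have "f u - f N = (f u - (f (k - 1) + f k) / 2) + (f (k - 1) - f k) / 2 + (f k - f N)"
    by (simp add: field_simps)
  also have "\<dots> \<le> \<Phi> * ((real k - real u) / 4 + 3) + \<Phi> / 2 + \<Phi> * (3 + (real N - real k) / 4)"
    using D E G by (intro add_mono divide_right_mono) auto
  also have "\<dots> \<le> \<Phi> * ((real N - real u) / 4 + 7)" using P by (simp add: field_simps)
  finally show ?thesis .
qed

end

section \<open>A discrete Sturm comparison\<close>

text \<open>A crude Jordan inequality: for z = y/2 at most pi/4, sin y = 2 sin z cos z \<ge> 2 z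
  (cos z)^2 \<ge> z.\<close>

lemma sin_ge_half:
  fixes y :: real
  assumes "0 \<le> y" "y \<le> pi / 2"
  shows "y / 2 \<le> sin y"
proof (cases "y = 0")
  case False
  define z where "z = y / 2"
  have z: "0 < z" "z \<le> pi / 4" "y = 2 * z" using assms False by (auto simp: z_def)
  obtain \<xi> where \<xi>: "0 < \<xi>" "\<xi> < z" "sin z - sin 0 = (z - 0) * cos \<xi>"
    using MVT2[of 0 z sin cos] z DERIV_sin by auto
  have "cos z \<le> cos \<xi>" using \<xi> z pi_gt_zero by (intro cos_monotone_0_pi_le) linarith+
  then have 1: "z * cos z \<le> sin z" using \<xi> z by simp
  have "cos (pi / 4) \<le> cos z" using z pi_gt_zero by (intro cos_monotone_0_pi_le) linarith+
  then have c: "sqrt 2 / 2 \<le> cos z" by (simp add: cos_45)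
  then have "(sqrt 2 / 2) ^ 2 \<le> cos z ^ 2" by (intro power_mono) auto
  then have "1 / 2 \<le> cos z ^ 2" by (simp add: power_divide)
  then have "z \<le> 2 * (z * cos z ^ 2)" using mult_left_mono[of "1/2" "cos z ^ 2" z] z by simp
  also have "\<dots> = 2 * (z * cos z) * cos z" by (simp add: power2_eq_square)
  also have "\<dots> \<le> 2 * sin z * cos z" using 1 order_trans[OF _ c, of 0]
    by (intro mult_right_mono mult_left_mono) auto
  also have "\<dots> = sin y" by (simp add: z sin_double)
  finally show ?thesis by (simp add: z)
qed simp

lemma cos_diff_le: "x \<le> y \<Longrightarrow> cos x - cos y \<le> (y - x :: real)"
proof -
  assume "x \<le> y"
  have "cos x - cos y = 2 * (sin ((x + y) / 2) * sin ((y - x) / 2))" by (simp add: cos_diff_cos)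
  also have "sin ((x + y) / 2) * sin ((y - x) / 2) \<le> \<bar>sin ((x + y) / 2)\<bar> * \<bar>sin ((y - x) / 2)\<bar>"
    by (metis abs_ge_self abs_mult)
  also have "\<dots> \<le> 1 * \<bar>(y - x) / 2\<bar>"
    by (intro mult_mono abs_sin_x_le_abs_x) auto
  finally show ?thesis using \<open>x \<le> y\<close> by simp
qed

lemma sum_sin_telescope:
  assumes "j \<le> N"
  shows "2 * sin (\<theta> / 2) * (\<Sum>l=j..N. sin (\<theta> * (real l + 1))) = cos (\<theta> * (j + 1/2)) - cos (\<theta> * (N + 3/2))"
  using assms
proof (induction N rule: dec_induct)
  case base
  show ?case by (simp add: cos_diff_cos algebra_simps add_divide_distrib)
next
  case (step n)
  have "2 * sin (\<theta> / 2) * sin (\<theta> * (real (Suc n) + 1)) = cos (\<theta> * (n + 3/2)) - cos (\<theta> * (Suc n + 3/2))"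
    by (simp add: cos_diff_cos algebra_simps add_divide_distrib)
  moreover have "(\<Sum>l=j..Suc n. sin (\<theta> * (real l + 1))) =
    (\<Sum>l=j..n. sin (\<theta> * (real l + 1))) + sin (\<theta> * (real (Suc n) + 1))"
    using step by simp
  ultimately show ?case using step.IH by (simp only: distrib_left)
qed

lemma sum_squares_ge: "real (N + 1) ^ 3 / 3 \<le> (\<Sum>l\<le>N. (real l + 1)\<^sup>2)"
proof (induction N)
  case (Suc N)
  then show ?case by (simp add: power2_eq_square power3_eq_cube field_simps)
qed simp

text \<open>Prefix averages of a decreasing sequence decrease; written without division.\<close>

lemma antimono_sum_ge:
  fixes f :: "nat \<Rightarrow> real"
  assumes anti: "\<And>i j. i \<le> j \<Longrightarrow> j \<le> N \<Longrightarrow> f j \<le> f i" and "l \<le> N"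
  shows "(real l + 1) * (\<Sum>j\<le>N. f j) \<le> (real N + 1) * (\<Sum>j\<le>l. f j)"
proof -
  have "{..N} = {..l} \<union> {l<..N}" using assms by auto
  then have "(\<Sum>j\<le>N. f j) = (\<Sum>j\<le>l. f j) + (\<Sum>j\<in>{l<..N}. f j)"
    by (simp add: sum.union_disjoint Int_def disjoint_iff)
  also have "(\<Sum>j\<in>{l<..N}. f j) \<le> (real N - real l) * f l"
    using sum_bounded_above[of "{l<..N}" f "f l"] anti assms by (auto simp: of_nat_diff)
  finally have 1: "(\<Sum>j\<le>N. f j) \<le> (\<Sum>j\<le>l. f j) + (real N - real l) * f l" by simp
  have 2: "(real l + 1) * f l \<le> (\<Sum>j\<le>l. f j)"
    using sum_bounded_below[of "{..l}" "f l" f] anti assms by (auto simp: add.commute)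
  have "(real l + 1) * (\<Sum>j\<le>N. f j) \<le> (real l + 1) * ((\<Sum>j\<le>l. f j) + (real N - real l) * f l)"
    using 1 by (intro mult_left_mono) auto
  also have "\<dots> = (real l + 1) * (\<Sum>j\<le>l. f j) + (real N - real l) * ((real l + 1) * f l)"
    by (simp add: algebra_simps)
  also have "\<dots> \<le> (real l + 1) * (\<Sum>j\<le>l. f j) + (real N - real l) * (\<Sum>j\<le>l. f j)"
    using 2 assms by (intro add_left_mono mult_left_mono) auto
  finally show ?thesis by (simp add: algebra_simps)
qed

text \<open>The inequality \<open>drop\<close> is tested against
  \<open>w l = sin (\<theta> * (l + 1))\<close> and summed by parts. The tail sums \<open>W\<close>
  of the weights satisfy w (j + m) - w j \<ge> \<kappa> W j, where \<kappa> is about m \<theta>^2,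
  and the sum of \<open>W j * f j\<close> equals \<open>Y\<close>, the sum of
  \<open>w l * F l\<close>. The boundary terms at the right end are O(1/N) relative to
  \<open>Y\<close>. The quarter period has length \<open>N + 2 * m\<close> rather than
  \<open>N\<close> to leave a margin at that end.\<close>

lemma discrete_sturm:
  fixes f :: "nat \<Rightarrow> real" and \<mu> \<rho> \<theta> \<kappa> :: real and N m :: nat
  assumes anti: "\<And>i j. i \<le> j \<Longrightarrow> j \<le> N \<Longrightarrow> f j \<le> f i" and f_N: "0 \<le> f N" and f_0: "0 < f 0"
    and m: "3 \<le> m" "2 * m \<le> N" and \<mu>: "0 \<le> \<mu>" and \<rho>: "0 \<le> \<rho>"
    and drop: "\<And>l. l \<le> N \<Longrightarrow> f (l - m) - f l \<le> \<rho> * \<mu> * (\<Sum>j\<le>l. f j)"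
    and end_value: "f N \<le> \<mu> * (\<Sum>j\<le>N. f j)"
  defines "\<theta> \<equiv> pi / (2 * (real N + 2 * real m))"
  defines "\<kappa> \<equiv> 4 * sin (\<theta> * m / 2) * sin (\<theta> / 2)"
  shows "\<kappa> \<le> \<mu> * (\<rho> + (m + \<kappa> * m\<^sup>2) * (\<rho> + 1) * 12 / (N + 1))"
proof -
  define w where "w l = sin (\<theta> * (real l + 1))" for l :: nat
  define F where "F l = (\<Sum>j\<le>l. f j)" for l
  define W where "W j = (\<Sum>l=j..N. w l)" for j
  define Y where "Y = (\<Sum>l\<le>N. w l * F l)"
  have S: "0 < real N + 2 * real m" using m by simp
  have \<theta>: "0 < \<theta>" using S by (simp add: \<theta>_def)
  have \<theta>S: "\<theta> * (real N + 2 * real m) = pi / 2" using S unfolding \<theta>_def by (simp add: field_simps)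
  have arg: "\<theta> * x \<le> pi / 2" if "x \<le> real N + 2 * real m" for x
    using mult_left_mono[OF that, of \<theta>] \<theta> \<theta>S by simp
  have f_nonneg: "0 \<le> f j" if "j \<le> N" for j using anti[of j N] f_N that by simp
  have w_lower: "\<theta> * (real l + 1) / 2 \<le> w l" if "l \<le> N" for l
    unfolding w_def using \<theta> that m by (intro sin_ge_half arg) auto
  have w_nonneg: "0 \<le> w l" if "l \<le> N" for l
    using order_trans[OF _ w_lower[OF that], of 0] \<theta> by simp
  have w_le: "w l \<le> 1" for l by (simp add: w_def)
  have \<kappa>: "0 \<le> \<kappa>" unfolding \<kappa>_def
  proof (intro mult_nonneg_nonneg sin_ge_zero)
    show "\<theta> * real m / 2 \<le> pi" "\<theta> / 2 \<le> pi"
      using arg[of "real m"] arg[of 1] m pi_gt_zero by linarith+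
  qed (use \<theta> in auto)
  have Y_swap: "Y = (\<Sum>j\<le>N. W j * f j)"
  proof -
    have "Y = (\<Sum>l\<le>N. \<Sum>j\<le>N. if j \<le> l then w l * f j else 0)"
      unfolding Y_def F_def sum_distrib_left
    proof (rule sum.cong[OF refl])
      fix l assume "l \<in> {..N}"
      then have "{..N} \<inter> {j. j \<le> l} = {..l}" by auto
      then show "(\<Sum>j\<le>l. w l * f j) = (\<Sum>j\<le>N. if j \<le> l then w l * f j else 0)"
        by (simp add: sum.If_cases)
    qed
    also have "\<dots> = (\<Sum>j\<le>N. \<Sum>l\<le>N. if j \<le> l then w l * f j else 0)" by (rule sum.swap)
    also have "\<dots> = (\<Sum>j\<le>N. W j * f j)"
      unfolding W_def sum_distrib_right
    proof (rule sum.cong[OF refl])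
      fix j assume "j \<in> {..N}"
      then have "{..N} \<inter> {l. j \<le> l} = {j..N}" by auto
      then show "(\<Sum>l\<le>N. if j \<le> l then w l * f j else 0) = (\<Sum>l=j..N. w l * f j)"
        by (simp add: sum.If_cases)
    qed
    finally show ?thesis .
  qed
  have split: "{..N} = {..N - m} \<union> {N - m<..N}" by auto
  have split_sum: "(\<Sum>j\<le>N. h j) = (\<Sum>j\<le>N - m. h j) + (\<Sum>j\<in>{N - m<..N}. h j)" for h :: "nat \<Rightarrow> real"
    by (subst split) (rule sum.union_disjoint, auto)
  have W_diff: "\<kappa> * W j \<le> w (j + m) - w j" if "j \<le> N - m" for j
  proof -
    have j: "j \<le> N" "real j + real m \<le> real N" using that m by (auto simp flip: of_nat_add)
    have tel: "2 * sin (\<theta> / 2) * W j = cos (\<theta> * (j + 1/2)) - cos (\<theta> * (N + 3/2))"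
      unfolding W_def w_def by (rule sum_sin_telescope[OF j(1)])
    \<comment> \<open>The phase shift of (m + 1)/2 is absorbed by cos (\<theta> (N + 3/2)), which
      equals sin (\<theta> (2m - 3/2)) thanks to the stretched period; \<open>3 \<le> m\<close>
      ensures m + 1 \<le> 2m - 3/2.\<close>
    have "cos (\<theta> * (j + 1/2)) - cos (\<theta> * (j + 1 + m/2)) \<le> \<theta> * (j + 1 + m/2) - \<theta> * (j + 1/2)"
      using \<theta> by (intro cos_diff_le mult_left_mono) auto
    also have "\<dots> = \<theta> * ((m + 1) / 2)" by (simp add: algebra_simps add_divide_distrib)
    also have "\<dots> \<le> \<theta> * (2 * m - 3/2) / 2" using \<theta> m by (simp add: field_simps)
    also have "\<dots> \<le> sin (\<theta> * (2 * m - 3/2))"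
      using \<theta> m by (intro sin_ge_half arg) auto
    also have "\<theta> * (2 * m - 3/2) = pi / 2 - \<theta> * (N + 3/2)"
      using \<theta>S by (simp add: algebra_simps)
    also have "sin \<dots> = cos (\<theta> * (N + 3/2))" by (simp add: sin_diff)
    finally have "2 * sin (\<theta> / 2) * W j \<le> cos (\<theta> * (j + 1 + m/2))" using tel by linarith
    moreover have "\<theta> * m / 2 \<le> pi" using arg[of "real m"] m pi_gt_zero by linarith
    then have "0 \<le> sin (\<theta> * m / 2)" using \<theta> by (intro sin_ge_zero) auto
    ultimately have "2 * sin (\<theta> * m / 2) * (2 * sin (\<theta> / 2) * W j) \<le> 2 * sin (\<theta> * m / 2) * cos (\<theta> * (j + 1 + m/2))"
      by (intro mult_left_mono) auto
    also have "\<dots> = w (j + m) - w j"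
      by (simp add: w_def sin_diff_sin algebra_simps add_divide_distrib)
    finally show ?thesis by (simp add: \<kappa>_def algebra_simps)
  qed
  have W_le: "W j \<le> m" if "j \<in> {N - m<..N}" for j
  proof -
    have "W j \<le> real (card {j..N}) * 1" unfolding W_def using w_le by (intro sum_bounded_above) auto
    also have "\<dots> \<le> m" using that m by auto
    finally show ?thesis .
  qed
  have tail1: "(\<Sum>j\<in>{N - m<..N}. w j * f j) \<le> m * f (N - m)"
  proof -
    have "(\<Sum>j\<in>{N - m<..N}. w j * f j) \<le> of_nat (card {N - m<..N}) * (1 * f (N - m))"
      using anti f_nonneg w_le w_nonneg by (intro sum_bounded_above mult_mono) auto
    then show ?thesis using m by simp
  qed
  have tail2: "(\<Sum>j\<in>{N - m<..N}. W j * f j) \<le> m\<^sup>2 * f (N - m)"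
  proof -
    have "(\<Sum>j\<in>{N - m<..N}. W j * f j) \<le> of_nat (card {N - m<..N}) * (m * f (N - m))"
      using anti f_nonneg W_le by (intro sum_bounded_above mult_mono) auto
    then show ?thesis using m by (simp add: power2_eq_square)
  qed
  have "(\<Sum>l\<le>N. w l * (f (l - m) - f l)) \<le> (\<Sum>l\<le>N. w l * (\<rho> * \<mu> * F l))"
    using drop w_nonneg by (intro sum_mono mult_left_mono) (auto simp: F_def)
  also have "\<dots> = \<rho> * \<mu> * Y" by (simp add: Y_def sum_distrib_left algebra_simps)
  finally have upper: "(\<Sum>l\<le>N. w l * (f (l - m) - f l)) \<le> \<rho> * \<mu> * Y" .
  have "(\<Sum>j\<le>N - m. w (j + m) * f j) = (\<Sum>l=m..N. w l * f (l - m))"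
    using m by (intro sum.reindex_bij_witness[of _ "\<lambda>l. l - m" "\<lambda>j. j + m"]) auto
  \<comment> \<open>The indices \<open>l < m\<close>, where \<open>l - m\<close> is 0, add
    nonnegative terms \<open>w l * f 0\<close>.\<close>
  also have "\<dots> \<le> (\<Sum>l\<le>N. w l * f (l - m))"
    using w_nonneg f_nonneg by (intro sum_mono2) auto
  finally have shift: "(\<Sum>j\<le>N - m. w (j + m) * f j) \<le> (\<Sum>l\<le>N. w l * f (l - m))" .
  have "\<kappa> * (\<Sum>j\<le>N - m. W j * f j) \<le> (\<Sum>j\<le>N - m. (w (j + m) - w j) * f j)"
    unfolding sum_distrib_left mult.assoc[symmetric]
    using W_diff f_nonneg by (intro sum_mono mult_right_mono) auto
  also have "\<dots> = (\<Sum>j\<le>N - m. w (j + m) * f j) - (\<Sum>j\<le>N - m. w j * f j)"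
    by (simp add: left_diff_distrib sum_subtractf)
  also have "\<dots> \<le> (\<Sum>l\<le>N. w l * f (l - m)) - ((\<Sum>l\<le>N. w l * f l) - m * f (N - m))"
    using shift tail1 split_sum[of "\<lambda>l. w l * f l"] by linarith
  also have "\<dots> = (\<Sum>l\<le>N. w l * (f (l - m) - f l)) + m * f (N - m)"
    by (simp add: right_diff_distrib sum_subtractf)
  finally have "\<kappa> * (\<Sum>j\<le>N - m. W j * f j) \<le> \<rho> * \<mu> * Y + m * f (N - m)" using upper by linarith
  moreover have "\<kappa> * (\<Sum>j\<in>{N - m<..N}. W j * f j) \<le> \<kappa> * (m\<^sup>2 * f (N - m))"
    using tail2 \<kappa> by (intro mult_left_mono)
  ultimately have main: "\<kappa> * Y \<le> \<rho> * \<mu> * Y + (m + \<kappa> * m\<^sup>2) * f (N - m)"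
    unfolding Y_swap split_sum[of "\<lambda>l. W l * f l"] by (simp add: algebra_simps)
  have FN: "0 < F N"
  proof -
    have "f 0 \<le> F N" unfolding F_def using f_nonneg by (intro member_le_sum) auto
    then show ?thesis using f_0 by simp
  qed
  have f_end: "f (N - m) \<le> (\<rho> + 1) * \<mu> * F N"
    using drop[of N] end_value by (simp add: F_def algebra_simps)
  \<comment> \<open>Linear lower bounds for both \<open>w l\<close> and \<open>F l\<close> leave a
    sum of squares; with \<theta> at least 1/(2 (N + 1)), which uses \<open>2 * m \<le> N\<close>,
    the constants multiply to 1/12.\<close>
  have "F N * ((N + 1) / 12) \<le> Y"
  proof -
    have termwise: "F N * (\<theta> / (2 * (N + 1))) * (real l + 1)\<^sup>2 \<le> w l * F l" if "l \<le> N" for l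
    proof -
      have "(\<theta> * (real l + 1) / 2) * ((real l + 1) * F N / (N + 1)) \<le> w l * F l"
      proof (rule mult_mono)
        show "(real l + 1) * F N / (N + 1) \<le> F l"
          using antimono_sum_ge[of N f l] anti that by (simp add: F_def field_simps)
      qed (use w_lower[OF that] w_nonneg[OF that] FN in auto)
      then show ?thesis by (simp add: power2_eq_square field_simps)
    qed
    have "pi / (4 * real (N + 1)) \<le> \<theta>"
      unfolding \<theta>_def using m by (intro divide_left_mono) auto
    moreover have "2 / (4 * real (N + 1)) \<le> pi / (4 * real (N + 1))"
      using pi_ge_two by (intro divide_right_mono) auto
    ultimately have \<theta>_ge: "2 / (4 * real (N + 1)) \<le> \<theta>" by linarith
    have "F N * ((N + 1) / 12) = F N * (2 / (4 * real (N + 1)) / (2 * (N + 1))) * (real (N + 1) ^ 3 / 3)"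
    proof -
      have "x * (y / 12) = x * (2 / (4 * y) / (2 * y)) * (y ^ 3 / 3)" if "0 < y" for x y :: real
        using that by (simp add: power3_eq_cube field_simps)
      from this[of "real (N + 1)" "F N"] show ?thesis by (simp only: of_nat_mult of_nat_numeral)
    qed
    also have "\<dots> \<le> F N * (\<theta> / (2 * (N + 1))) * (\<Sum>l\<le>N. (real l + 1)\<^sup>2)"
      using \<theta>_ge FN \<theta> by (intro mult_mono mult_left_mono divide_right_mono sum_squares_ge) auto
    also have "\<dots> \<le> Y" unfolding Y_def sum_distrib_left using termwise by (intro sum_mono) auto
    finally show ?thesis .
  qed
  then have FY: "F N \<le> 12 * Y / (N + 1)" by (simp add: field_simps)
  have "0 < F N * ((N + 1) / 12)" using FN by simp
  then have Y: "0 < Y" using \<open>F N * ((N + 1) / 12) \<le> Y\<close> by linarith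
  have "(m + \<kappa> * m\<^sup>2) * f (N - m) \<le> (m + \<kappa> * m\<^sup>2) * ((\<rho> + 1) * \<mu> * (12 * Y / (N + 1)))"
  proof (intro mult_left_mono)
    show "f (N - m) \<le> (\<rho> + 1) * \<mu> * (12 * Y / (N + 1))"
      using f_end mult_left_mono[OF FY, of "(\<rho> + 1) * \<mu>"] \<rho> \<mu> by simp
  qed (use \<kappa> in auto)
  with main have "\<kappa> * Y \<le> \<rho> * \<mu> * Y + (m + \<kappa> * m\<^sup>2) * ((\<rho> + 1) * \<mu> * (12 * Y / (N + 1)))" by linarith
  also have "\<dots> = \<mu> * (\<rho> + (m + \<kappa> * m\<^sup>2) * (\<rho> + 1) * 12 / (N + 1)) * Y"
    by (simp add: field_simps)
  finally show ?thesis using Y by simp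
qed

text \<open>For fixed \<open>m\<close>, \<kappa> behaves like m (pi / (2N))^2, and the boundary term
  in the denominator vanishes in the limit.\<close>

lemma sturm_constant_limit:
  fixes m \<rho> :: real and \<kappa> :: "nat \<Rightarrow> real"
  assumes "0 < m" "0 < \<rho>"
  defines "\<kappa> \<equiv> \<lambda>N. 4 * sin (pi / (2 * (real N + 2 * m)) * m / 2) * sin (pi / (2 * (real N + 2 * m)) / 2)"
  shows "(\<lambda>N. (real N + 1)\<^sup>2 * \<kappa> N / (\<rho> + (m + \<kappa> N * m\<^sup>2) * (\<rho> + 1) * 12 / (real N + 1)))
     \<longlonglongrightarrow> m * pi\<^sup>2 / (4 * \<rho>)"
proof -
  have "(\<lambda>N. (real N + 1)\<^sup>2 * \<kappa> N) \<longlonglongrightarrow> pi * m * pi / 4"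
    unfolding \<kappa>_def using assms(1) by real_asymp
  then have lim: "(\<lambda>N. (real N + 1)\<^sup>2 * \<kappa> N) \<longlonglongrightarrow> m * pi\<^sup>2 / 4"
    by (simp add: power2_eq_square mult_ac)
  have "\<kappa> \<longlonglongrightarrow> 0"
    unfolding \<kappa>_def using assms(1) by real_asymp
  moreover have "(\<lambda>N::nat. 1 / (real N + 1)) \<longlonglongrightarrow> 0" by real_asymp
  ultimately have "(\<lambda>N. \<rho> + (m + \<kappa> N * m\<^sup>2) * (\<rho> + 1) * 12 * (1 / (real N + 1))) \<longlonglongrightarrow>
      \<rho> + (m + 0 * m\<^sup>2) * (\<rho> + 1) * 12 * 0"
    by (intro tendsto_intros)
  with lim have "(\<lambda>N. (real N + 1)\<^sup>2 * \<kappa> N / (\<rho> + (m + \<kappa> N * m\<^sup>2) * (\<rho> + 1) * 12 * (1 / (real N + 1))))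
     \<longlonglongrightarrow> (m * pi\<^sup>2 / 4) / (\<rho> + (m + 0 * m\<^sup>2) * (\<rho> + 1) * 12 * 0)"
    using assms(2) by (intro tendsto_divide) auto
  then show ?thesis by simp
qed

text \<open>A long window \<open>m\<close> dilutes the additive constant \<open>C\<close>, after
  which \<open>discrete_sturm\<close> settles all large \<open>N\<close>. The position
  \<open>N\<close> of the first deficient vertex is not controlled, so \<open>n\<^sub>0\<close> must
  be uniform in it: for bounded \<open>N\<close> the gap \<mu> is bounded below by a constant, and
  the factor n^2 wins.\<close>

lemma gap_lower_bound:
  fixes r C \<epsilon> :: real
  assumes r: "0 < r" and C: "0 \<le> C" and \<epsilon>: "0 < \<epsilon>"
  obtains n\<^sub>0 where "\<And>n N f \<mu>. \<lbrakk>n\<^sub>0 \<le> n; N < n; \<And>i j. i \<le> j \<Longrightarrow> j \<le> N \<Longrightarrow> f j \<le> f i; 0 \<le> f N; 0 < f 0; 0 \<le> \<mu>;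
    \<And>u l. u \<le> l \<Longrightarrow> l \<le> N \<Longrightarrow> f u - f l \<le> \<mu> * (\<Sum>j\<le>l. f j) * (r * (real l - real u) + C);
    f N \<le> \<mu> * (\<Sum>j\<le>N. f j)\<rbrakk> \<Longrightarrow> pi\<^sup>2 / (4 * r) - \<epsilon> \<le> (real n)\<^sup>2 * \<mu>"
proof -
  have "(\<lambda>m. real m * pi\<^sup>2 / (4 * (r * real m + C))) \<longlonglongrightarrow> pi\<^sup>2 * inverse r / 4"
    using r by real_asymp
  then have "(\<lambda>m. real m * pi\<^sup>2 / (4 * (r * real m + C))) \<longlonglongrightarrow> pi\<^sup>2 / (4 * r)"
    by (simp add: field_simps)
  then have "\<forall>\<^sub>F m in sequentially. pi\<^sup>2 / (4 * r) - \<epsilon> < real m * pi\<^sup>2 / (4 * (r * real m + C))"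
    using \<epsilon> by (intro order_tendstoD(1)) auto
  then obtain m where m: "3 \<le> m" "pi\<^sup>2 / (4 * r) - \<epsilon> < real m * pi\<^sup>2 / (4 * (r * real m + C))"
    by (metis (no_types, lifting) eventually_sequentially max.cobounded1 max.cobounded2)
  define \<rho> where "\<rho> = r * m + C"
  have \<rho>: "0 < \<rho>" using r C m by (simp add: \<rho>_def add_pos_nonneg)
  define \<kappa> where "\<kappa> N = 4 * sin (pi / (2 * (real N + 2 * m)) * m / 2) * sin (pi / (2 * (real N + 2 * m)) / 2)" for N
  have "\<forall>\<^sub>F N in sequentially. pi\<^sup>2 / (4 * r) - \<epsilon> <
      (real N + 1)\<^sup>2 * \<kappa> N / (\<rho> + (m + \<kappa> N * m\<^sup>2) * (\<rho> + 1) * 12 / (real N + 1))"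
    using sturm_constant_limit[of "real m" \<rho>] m \<rho> unfolding \<kappa>_def
    by (intro order_tendstoD(1)[where y = "real m * pi\<^sup>2 / (4 * \<rho>)"]) (auto simp: \<rho>_def)
  then obtain N\<^sub>1 where N\<^sub>1: "\<And>N. N\<^sub>1 \<le> N \<Longrightarrow> pi\<^sup>2 / (4 * r) - \<epsilon> <
      (real N + 1)\<^sup>2 * \<kappa> N / (\<rho> + (m + \<kappa> N * m\<^sup>2) * (\<rho> + 1) * 12 / (real N + 1))"
    by (auto simp: eventually_sequentially)
  define M where "M = max N\<^sub>1 (2 * m)"
  \<comment> \<open>Chosen so that \<open>drop\<close> from 0 to \<open>N\<close> together with
    \<open>end_value\<close> yields \<open>1 \<le> \<mu> * K\<close> whenever
    \<open>N < M\<close>.\<close>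
  define K where "K = (real M + 1) * (r * M + C + 1)"
  obtain n\<^sub>0 :: nat where n\<^sub>0: "pi\<^sup>2 / (4 * r) * K + 1 \<le> real n\<^sub>0" using real_arch_simple by blast
  show thesis
  proof (rule that[of n\<^sub>0])
    fix n N :: nat and f :: "nat \<Rightarrow> real" and \<mu> :: real
    assume n: "n\<^sub>0 \<le> n" "N < n" and anti: "\<And>i j. i \<le> j \<Longrightarrow> j \<le> N \<Longrightarrow> f j \<le> f i"
      and f: "0 \<le> f N" "0 < f 0" and \<mu>: "0 \<le> \<mu>"
      and drop: "\<And>u l. u \<le> l \<Longrightarrow> l \<le> N \<Longrightarrow> f u - f l \<le> \<mu> * (\<Sum>j\<le>l. f j) * (r * (real l - real u) + C)"
      and end_value: "f N \<le> \<mu> * (\<Sum>j\<le>N. f j)"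
    have f_nonneg: "0 \<le> f j" if "j \<le> N" for j using anti[of j N] f that by simp
    show "pi\<^sup>2 / (4 * r) - \<epsilon> \<le> (real n)\<^sup>2 * \<mu>"
    proof (cases "M \<le> N")
      case True
      have window: "f (l - m) - f l \<le> \<rho> * \<mu> * (\<Sum>j\<le>l. f j)" if "l \<le> N" for l
      proof -
        have "f (l - m) - f l \<le> \<mu> * (\<Sum>j\<le>l. f j) * (r * (real l - real (l - m)) + C)"
          using drop that by simp
        also have "\<dots> \<le> \<mu> * (\<Sum>j\<le>l. f j) * \<rho>"
          unfolding \<rho>_def using \<mu> f_nonneg that r
          by (intro mult_left_mono add_right_mono mult_nonneg_nonneg sum_nonneg) auto
        finally show ?thesis by (simp add: algebra_simps)
      qed
      let ?d = "\<rho> + (m + \<kappa> N * m\<^sup>2) * (\<rho> + 1) * 12 / (real N + 1)"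
      have "\<kappa> N \<le> \<mu> * ?d"
        using discrete_sturm[of N f m \<mu> \<rho>] anti f m True \<mu> \<rho> window end_value
        unfolding M_def \<kappa>_def by (auto simp: add.commute)
      moreover have "0 < ?d"
      proof -
        have "0 \<le> \<kappa> N" unfolding \<kappa>_def
          using m mult_left_mono[of 1 "4 * real N + 8 * real m" pi]
          by (intro mult_nonneg_nonneg sin_ge_zero) (auto simp: field_simps)
        then show ?thesis using \<rho> by (intro add_pos_nonneg) auto
      qed
      ultimately have "\<kappa> N / ?d \<le> \<mu>" by (simp add: divide_le_eq)
      then have "(real N + 1)\<^sup>2 * (\<kappa> N / ?d) \<le> (real N + 1)\<^sup>2 * \<mu>" by (intro mult_left_mono) auto
      also have "\<dots> \<le> (real n)\<^sup>2 * \<mu>" using n \<mu> by (intro mult_right_mono power_mono) auto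
      finally show ?thesis using N\<^sub>1[of N] True by (simp add: M_def)
    next
      case False
      have S: "(\<Sum>j\<le>N. f j) \<le> (real N + 1) * f 0"
        using sum_bounded_above[of "{..N}" f "f 0"] anti by (auto simp: add.commute)
      have NM: "real N \<le> real M" using False by simp
      have "f 0 \<le> \<mu> * (\<Sum>j\<le>N. f j) * (r * real N + C + 1)"
        using drop[of 0 N] end_value by (simp add: algebra_simps)
      also have "\<dots> \<le> \<mu> * ((real N + 1) * f 0) * (r * real N + C + 1)"
        using S \<mu> r C by (intro mult_right_mono mult_left_mono) auto
      also have "\<dots> \<le> \<mu> * ((real M + 1) * f 0) * (r * real M + C + 1)"
        using NM \<mu> r C f by (intro mult_mono mult_left_mono mult_right_mono add_mono) auto
      also have "\<dots> = (\<mu> * K) * f 0" by (simp add: K_def)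
      finally have \<mu>K: "1 \<le> \<mu> * K" using f by simp
      have "pi\<^sup>2 / (4 * r) * K + 1 \<le> real n" using n\<^sub>0 n by linarith
      moreover have K: "0 \<le> K" unfolding K_def using r C by (intro mult_nonneg_nonneg) auto
      moreover have pr: "0 \<le> pi\<^sup>2 / (4 * r)" using r by simp
      ultimately have n1: "1 \<le> real n" "pi\<^sup>2 / (4 * r) * K \<le> real n"
        using mult_nonneg_nonneg[OF pr K] by linarith+
      have "pi\<^sup>2 / (4 * r) \<le> pi\<^sup>2 / (4 * r) * (\<mu> * K)" using mult_left_mono[OF \<mu>K pr] by simp
      also have "\<dots> = pi\<^sup>2 / (4 * r) * K * \<mu>" by simp
      also have "\<dots> \<le> (real n)\<^sup>2 * \<mu>"
        using n1 \<mu> self_le_power[of "real n" 2] by (intro mult_right_mono) linarith+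
      finally show ?thesis using \<epsilon> by simp
    qed
  qed
qed

section \<open>Level cuts of a Perron vector\<close>

locale ordered_graph =
  fixes n :: nat and E :: "nat \<Rightarrow> nat \<Rightarrow> bool" and f :: "nat \<Rightarrow> real"
  assumes E_less: "E i j \<Longrightarrow> i < n \<and> j < n"
    and E_sym: "E i j \<Longrightarrow> E j i"
    and E_irrefl: "\<not> E i i"
    and f_antimono: "i \<le> j \<Longrightarrow> j < n \<Longrightarrow> f j \<le> f i"
begin

definition cut :: "nat \<Rightarrow> (nat \<times> nat) set" where
  "cut k = {(i, j). i < k \<and> k \<le> j \<and> E i j}"

definition skip :: "nat \<Rightarrow> (nat \<times> nat) set" where
  "skip v = {(i, j). i < v \<and> v < j \<and> E i j}"

definition earlier :: "nat \<Rightarrow> nat set" where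
  "earlier v = {i. i < v \<and> E i v}"

definition later :: "nat \<Rightarrow> nat set" where
  "later v = {j. v < j \<and> E v j}"

lemma finite_arcs: "finite {(i, j). E i j}"
  by (rule finite_subset[of _ "{..<n} \<times> {..<n}"]) (use E_less in auto)

lemma finite_sets [simp]:
  "finite (cut k)" "finite (skip k)" "finite (earlier k)" "finite (later k)" "finite {j. E i j}"
proof -
  show "finite (cut k)" "finite (skip k)"
    by (auto intro!: finite_subset[OF _ finite_arcs] simp: cut_def skip_def)
  show "finite (earlier k)" "finite (later k)" "finite {j. E i j}"
    by (auto intro!: finite_subset[of _ "{..<n}"] simp: earlier_def later_def dest: E_less)
qed

lemma card_cut_in: "card (cut v) = card (skip v) + card (earlier v)"
proof -
  have "cut v = skip v \<union> (\<lambda>i. (i, v)) ` earlier v"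
    by (auto simp: cut_def skip_def earlier_def le_less)
  moreover have "skip v \<inter> (\<lambda>i. (i, v)) ` earlier v = {}" by (auto simp: skip_def)
  ultimately have "card (cut v) = card (skip v) + card ((\<lambda>i. (i, v)) ` earlier v)"
    by (simp add: card_Un_disjoint)
  then show ?thesis by (simp add: card_image inj_on_def)
qed

lemma card_cut_out: "card (cut (Suc v)) = card (skip v) + card (later v)"
proof -
  have "cut (Suc v) = skip v \<union> Pair v ` later v"
    by (auto simp: cut_def skip_def later_def less_Suc_eq)
  moreover have "skip v \<inter> Pair v ` later v = {}" by (auto simp: skip_def)
  ultimately have "card (cut (Suc v)) = card (skip v) + card (Pair v ` later v)"
    by (simp add: card_Un_disjoint)
  then show ?thesis by (simp add: card_image inj_on_def)
qed

lemma card_neighbours: "card (earlier v) + card (later v) = card {j. E v j}"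
proof -
  have "{j. E v j} = earlier v \<union> later v"
    using E_sym E_irrefl by (auto simp: earlier_def later_def) (metis nat_neq_iff)
  moreover have "earlier v \<inter> later v = {}" by (auto simp: earlier_def later_def)
  ultimately show ?thesis by (simp add: card_Un_disjoint)
qed

lemma card_earlier_Suc: "card (earlier (Suc v)) \<le> card (skip v) + 1"
proof -
  let ?g = "\<lambda>i. (i, Suc v)"
  have "?g ` earlier (Suc v) \<subseteq> insert (v, Suc v) (skip v)"
    by (auto simp: earlier_def skip_def)
  then have "card (?g ` earlier (Suc v)) \<le> card (insert (v, Suc v) (skip v))"
    by (intro card_mono) auto
  also have "\<dots> \<le> card (skip v) + 1" by (simp add: card_insert_if)
  finally show ?thesis by (simp add: card_image inj_on_def)
qed

text \<open>An edge arriving at one of these vertices passes over \<open>v\<close> unless both its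
  ends are among \<open>v\<close> and its two successors, which leaves the three pairs in
  \<open>?T\<close>.\<close>

lemma card_earlier_Suc2:
  "card (earlier (Suc v)) + card (earlier (Suc (Suc v))) \<le> card (skip v) + 3"
proof -
  let ?g = "\<lambda>i. (i, Suc v)" and ?h = "\<lambda>i. (i, Suc (Suc v))"
  let ?T = "{(v, Suc v), (v, Suc (Suc v)), (Suc v, Suc (Suc v))}"
  have "?g ` earlier (Suc v) \<union> ?h ` earlier (Suc (Suc v)) \<subseteq> ?T \<union> skip v"
    by (auto simp: earlier_def skip_def less_Suc_eq)
  then have "card (?g ` earlier (Suc v) \<union> ?h ` earlier (Suc (Suc v))) \<le> card (?T \<union> skip v)"
    by (intro card_mono) auto
  also have "\<dots> \<le> card ?T + card (skip v)" by (rule card_Un_le)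
  also have "card ?T = 3" by simp
  finally have "card (?g ` earlier (Suc v) \<union> ?h ` earlier (Suc (Suc v))) \<le> 3 + card (skip v)" .
  moreover have "card (?g ` earlier (Suc v) \<union> ?h ` earlier (Suc (Suc v))) =
      card (?g ` earlier (Suc v)) + card (?h ` earlier (Suc (Suc v)))"
    by (intro card_Un_disjoint) auto
  ultimately show ?thesis by (simp add: card_image inj_on_def)
qed

definition flow :: "nat \<Rightarrow> real" where
  "flow k = (\<Sum>(i, j)\<in>cut k. f i - f j)"

text \<open>A crossing edge drops by at least the sum of those of the three gaps around
  \<open>k\<close> that it spans; counting edges by the outer gaps they span gives the
  multiplicities.\<close>

lemma flow_ge:
  assumes "0 < k" "Suc k < n"
  shows "card (cut k) * (f (k - 1) - f k) + card (skip (k - 1)) * (f (k - 2) - f (k - 1)) +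
    card (skip k) * (f k - f (Suc k)) \<le> flow k"
proof -
  have 1: "skip (k - 1) = cut k \<inter> {(i, j). i < k - 1}" and 2: "skip k = cut k \<inter> {(i, j). k < j}"
    using assms by (auto simp: skip_def cut_def)
  have count: "(\<Sum>p\<in>cut k. if P p then x else 0) = card (cut k \<inter> {p. P p}) * x" for P and x :: real
    by (simp add: sum.If_cases)
  have "card (cut k) * (f (k - 1) - f k) + card (skip (k - 1)) * (f (k - 2) - f (k - 1)) +
      card (skip k) * (f k - f (Suc k)) =
    (\<Sum>p\<in>cut k. (f (k - 1) - f k) + (if case p of (i, j) \<Rightarrow> i < k - 1 then f (k - 2) - f (k - 1) else 0) +
      (if case p of (i, j) \<Rightarrow> k < j then f k - f (Suc k) else 0))"
    unfolding sum.distrib count 1 2 by (simp add: case_prod_unfold)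
  also have "\<dots> \<le> flow k"
    unfolding flow_def
  proof (rule sum_mono, clarify)
    fix i j assume ij: "(i, j) \<in> cut k"
    then have less: "i < k" "k \<le> j" "j < n" by (auto simp: cut_def dest: E_less)
    have "f (k - 1) + (if i < k - 1 then f (k - 2) - f (k - 1) else 0) \<le> f i"
      using f_antimono[of i "k - 2"] f_antimono[of i "k - 1"] less assms by auto
    moreover have "f j \<le> f k - (if k < j then f k - f (Suc k) else 0)"
      using f_antimono[of k j] f_antimono[of "Suc k" j] less by auto
    ultimately show "f (k - 1) - f k + (if i < k - 1 then f (k - 2) - f (k - 1) else 0) +
        (if k < j then f k - f (Suc k) else 0) \<le> f i - f j" by linarith
  qed
  finally show ?thesis .
qed

lemma flow_ge_gap:
  assumes "0 < k" "k < n"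
  shows "card (cut k) * (f (k - 1) - f k) \<le> flow k"
proof -
  have "card (cut k) * (f (k - 1) - f k) = (\<Sum>p\<in>cut k. f (k - 1) - f k)" by simp
  also have "\<dots> \<le> flow k" unfolding flow_def
  proof (rule sum_mono, clarify)
    fix i j assume "(i, j) \<in> cut k"
    then have "i \<le> k - 1" "k \<le> j" "j < n" "k - 1 < n" using assms by (auto simp: cut_def dest: E_less)
    then show "f (k - 1) - f k \<le> f i - f j"
      using f_antimono[of i "k - 1"] f_antimono[of k j] assms by simp
  qed
  finally show ?thesis .
qed

lemma flow_nonneg: "0 \<le> flow k"
  unfolding flow_def
proof (rule sum_nonneg, clarify)
  fix i j assume "(i, j) \<in> cut k"
  then have "i \<le> j" "j < n" by (auto simp: cut_def dest: E_less)
  then show "0 \<le> f i - f j" using f_antimono by simp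
qed

text \<open>Edges inside the first \<open>k\<close> vertices occur in both orientations and
  cancel.\<close>

lemma flow_eq: "flow k = (\<Sum>i<k. \<Sum>j | E i j. f i - f j)"
proof -
  let ?I = "{(i, j). i < k \<and> j < k \<and> E i j}"
  have fin: "finite ?I" by (rule finite_subset[OF _ finite_arcs]) auto
  have "(\<Sum>i<k. \<Sum>j | E i j. f i - f j) = (\<Sum>(i, j)\<in>(SIGMA i:{..<k}. {j. E i j}). f i - f j)"
    by (subst sum.Sigma) auto
  also have "(SIGMA i:{..<k}. {j. E i j}) = cut k \<union> ?I" by (auto simp: cut_def)
  also have "(\<Sum>(i, j)\<in>\<dots>. f i - f j) = flow k + (\<Sum>(i, j)\<in>?I. f i - f j)"
    unfolding flow_def by (rule sum.union_disjoint[OF finite_sets(1) fin]) (auto simp: cut_def)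
  also have "(\<Sum>(i, j)\<in>?I. f i - f j) = 0"
  proof -
    have "(\<Sum>(i, j)\<in>?I. f i - f j) = (\<Sum>(i, j)\<in>?I. f j - f i)"
      by (rule sum.reindex_bij_witness[of _ prod.swap prod.swap]) (auto intro: E_sym)
    also have "\<dots> = - (\<Sum>(i, j)\<in>?I. f i - f j)"
      by (simp add: case_prod_unfold flip: sum_negf)
    finally show ?thesis by simp
  qed
  finally show ?thesis by simp
qed

text \<open>The eigenvalue equation in Laplacian form, summed over a prefix: what the source \<mu> f
  produces leaves through the cut or drains at vertices of degree below \<open>D\<close>.\<close>

lemma flow_balance:
  assumes eigen: "\<And>i. i < n \<Longrightarrow> (\<Sum>j | E i j. f j) = (D - \<mu>) * f i" and "k \<le> n"
  shows "flow k + (\<Sum>i<k. (D - card {j. E i j}) * f i) = \<mu> * (\<Sum>i<k. f i)"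
proof -
  have "flow k = (\<Sum>i<k. \<mu> * f i - (D - card {j. E i j}) * f i)"
    unfolding flow_eq
  proof (rule sum.cong[OF refl])
    fix i assume "i \<in> {..<k}"
    then show "(\<Sum>j | E i j. f i - f j) = \<mu> * f i - (D - card {j. E i j}) * f i"
      using eigen[of i] \<open>k \<le> n\<close> by (simp add: sum_subtractf algebra_simps)
  qed
  then show ?thesis by (simp add: sum_subtractf sum_distrib_left)
qed

end

text \<open>\<open>N\<close> is the first vertex of deficient degree in the order of decreasing
  \<open>f\<close>; connectedness takes the form that no prefix cut is empty.\<close>

locale perron_ordered_graph = ordered_graph +
  fixes D :: nat and \<mu> :: real and N :: nat
  assumes f_nonneg: "i < n \<Longrightarrow> 0 \<le> f i" and f_0: "0 < f 0"
    and eigen: "i < n \<Longrightarrow> (\<Sum>j | E i j. f j) = (D - \<mu>) * f i"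
    and degree_le: "i < n \<Longrightarrow> card {j. E i j} \<le> D"
    and connected: "0 < k \<Longrightarrow> k < n \<Longrightarrow> \<exists>i j. i < k \<and> k \<le> j \<and> E i j"
    and N_less: "N < n" and degree_N: "card {j. E N j} < D"
    and degree_before: "i < N \<Longrightarrow> card {j. E i j} = D"
begin

lemma flow_le: "k \<le> n \<Longrightarrow> flow k \<le> \<mu> * (\<Sum>i<k. f i)"
proof -
  assume k: "k \<le> n"
  have "0 \<le> (\<Sum>i<k. (real D - card {j. E i j}) * f i)"
    using degree_le f_nonneg k by (intro sum_nonneg mult_nonneg_nonneg) auto
  then show ?thesis using flow_balance[of "real D" \<mu> k] eigen k by simp
qed

lemma \<mu>_nonneg: "0 \<le> \<mu>"
proof -
  have "0 \<le> \<mu> * f 0" using flow_le[of 1] flow_nonneg[of 1] N_less by simp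
  then show ?thesis using f_0 by (simp add: zero_le_mult_iff)
qed

text \<open>The missing degree at \<open>N\<close> drains at least \<open>f N\<close>, and the
  balance bounds everything that drains from the first \<open>Suc N\<close> vertices.\<close>

lemma end_value: "f N \<le> \<mu> * (\<Sum>j\<le>N. f j)"
proof -
  have "f N \<le> (real D - card {j. E N j}) * f N"
    using mult_right_mono[of 1 "real D - card {j. E N j}" "f N"] degree_N f_nonneg[of N] N_less by simp
  also have "\<dots> \<le> (\<Sum>i<Suc N. (real D - card {j. E i j}) * f i)"
    using degree_le f_nonneg N_less
    by (intro member_le_sum[of N _ "\<lambda>i. (real D - card {j. E i j}) * f i"] mult_nonneg_nonneg) auto
  also have "\<dots> \<le> \<mu> * (\<Sum>i<Suc N. f i)"
    using flow_balance[of "real D" \<mu> "Suc N"] eigen flow_nonneg[of "Suc N"] N_less by simp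
  finally show ?thesis by (simp add: lessThan_Suc_atMost)
qed

text \<open>Every prefix up to \<open>N\<close> is a profile of its own, and its flow bound grows
  with the partial sum of \<open>f\<close>. This dependence on \<open>l\<close> is what produces the
  second-order inequality for the partial sums.\<close>

lemma cut_profile:
  assumes l: "l \<le> N"
  shows "cut_profile l D (\<lambda>v. card (earlier v)) (\<lambda>v. card (later v)) (\<lambda>k. card (cut k)) (\<lambda>v. card (skip v))
    f (\<mu> * (\<Sum>j\<le>l. f j))"
proof
  have mono: "\<mu> * (\<Sum>i<k. f i) \<le> \<mu> * (\<Sum>j\<le>l. f j)" if "k \<le> l" for k
    using that l N_less f_nonneg \<mu>_nonneg by (intro mult_left_mono sum_mono2) auto
  have pos: "0 < card (cut k)" if "0 < k" "k \<le> l" for k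
  proof -
    have "cut k \<noteq> {}" using connected[of k] that l N_less by (auto simp: cut_def)
    then show ?thesis by (simp add: card_gt_0_iff)
  qed
  show "v < l \<Longrightarrow> card (cut v) = card (skip v) + card (earlier v)" for v by (rule card_cut_in)
  show "v < l \<Longrightarrow> card (cut (Suc v)) = card (skip v) + card (later v)" for v by (rule card_cut_out)
  show "v < l \<Longrightarrow> card (earlier v) + card (later v) = D" for v
    using card_neighbours degree_before l by simp
  show "card (cut 0) = 0" by (simp add: cut_def)
  show "0 < k \<Longrightarrow> k \<le> l \<Longrightarrow> 0 < card (cut k)" for k by (rule pos)
  show "Suc v < l \<Longrightarrow> card (earlier (Suc v)) \<le> card (skip v) + 1" for v by (rule card_earlier_Suc)
  show "Suc (Suc v) < l \<Longrightarrow> card (earlier (Suc v)) + card (earlier (Suc (Suc v))) \<le> card (skip v) + 3" for v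
    by (rule card_earlier_Suc2)
  show "i \<le> j \<Longrightarrow> j \<le> l \<Longrightarrow> f j \<le> f i" for i j using f_antimono l N_less by simp
  show "card (cut k) * (f (k - 1) - f k) + card (skip (k - 1)) * (f (k - 2) - f (k - 1)) +
      card (skip k) * (f k - f (Suc k)) \<le> \<mu> * (\<Sum>j\<le>l. f j)" if "0 < k" "k < l" for k
    using flow_ge[of k] flow_le[of k] mono[of k] that l N_less by linarith
  \<comment> \<open>\<open>flow_ge\<close> would involve \<open>f (Suc l)\<close>, and
    \<open>l\<close> may be the last vertex of the graph; the bound for a single gap avoids
    this.\<close>
  show "f (l - 1) - f l \<le> \<mu> * (\<Sum>j\<le>l. f j)" if "0 < l"
  proof -
    have "f (l - 1) - f l \<le> card (cut l) * (f (l - 1) - f l)"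
      using mult_right_mono[of 1 "real (card (cut l))" "f (l - 1) - f l"] pos[of l] that
        f_antimono[of "l - 1" l] l N_less by simp
    then show ?thesis using flow_ge_gap[of l] flow_le[of l] mono[of l] that l N_less by simp
  qed
  show "0 \<le> \<mu> * (\<Sum>j\<le>l. f j)"
    using \<mu>_nonneg f_nonneg l N_less by (intro mult_nonneg_nonneg sum_nonneg) auto
qed

end

lemma cubic_gap_lower_bound:
  assumes "0 < \<epsilon>"
  obtains n\<^sub>0 where "\<And>n E f \<mu> N. n\<^sub>0 \<le> n \<Longrightarrow> perron_ordered_graph n E f 3 \<mu> N \<Longrightarrow>
    pi\<^sup>2 / 2 - \<epsilon> \<le> (real n)\<^sup>2 * \<mu>"
\<comment> \<open>Resistance r = 1/2 gives pi^2 / (4 r) = pi^2 / 2; 4 is the additive constant of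
  the cubic \<open>drop_bound\<close>.\<close>
proof (rule gap_lower_bound[of "1/2" 4 \<epsilon>])
  fix n\<^sub>0
  assume bound: "\<And>n N f \<mu>. \<lbrakk>n\<^sub>0 \<le> n; N < n; \<And>i j. i \<le> j \<Longrightarrow> j \<le> N \<Longrightarrow> f j \<le> f i; 0 \<le> f N; 0 < f 0; 0 \<le> \<mu>;
    \<And>u l. u \<le> l \<Longrightarrow> l \<le> N \<Longrightarrow> f u - f l \<le> \<mu> * (\<Sum>j\<le>l. f j) * (1/2 * (real l - real u) + 4);
    f N \<le> \<mu> * (\<Sum>j\<le>N. f j)\<rbrakk> \<Longrightarrow> pi\<^sup>2 / (4 * (1/2)) - \<epsilon> \<le> (real n)\<^sup>2 * \<mu>"
  show thesis
  proof (rule that[of n\<^sub>0])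
    fix n E f \<mu> N
    assume n: "n\<^sub>0 \<le> n" and "perron_ordered_graph n E f 3 \<mu> N"
    then interpret perron_ordered_graph n E f 3 \<mu> N by simp
    have "pi\<^sup>2 / (4 * (1/2)) - \<epsilon> \<le> (real n)\<^sup>2 * \<mu>"
    proof (rule bound[of n N f \<mu>])
      fix u l assume "u \<le> l" "l \<le> N"
      interpret cubic_cut_profile l "\<lambda>v. card (earlier v)" "\<lambda>v. card (later v)" "\<lambda>k. card (cut k)"
        "\<lambda>v. card (skip v)" f "\<mu> * (\<Sum>j\<le>l. f j)"
        unfolding cubic_cut_profile_def by (rule cut_profile[OF \<open>l \<le> N\<close>])
      show "f u - f l \<le> \<mu> * (\<Sum>j\<le>l. f j) * (1/2 * (real l - real u) + 4)"
        using drop_bound[OF \<open>u \<le> l\<close>] by simp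
    qed (use n N_less f_antimono f_nonneg f_0 \<mu>_nonneg end_value in auto)
    then show "pi\<^sup>2 / 2 - \<epsilon> \<le> (real n)\<^sup>2 * \<mu>" by simp
  qed
qed (use assms in auto)

lemma quartic_gap_lower_bound:
  assumes "0 < \<epsilon>"
  obtains n\<^sub>0 where "\<And>n E f \<mu> N. n\<^sub>0 \<le> n \<Longrightarrow> perron_ordered_graph n E f 4 \<mu> N \<Longrightarrow>
    pi\<^sup>2 - \<epsilon> \<le> (real n)\<^sup>2 * \<mu>"
\<comment> \<open>Here r = 1/4, and 7 is the additive constant of the quartic
  \<open>drop_bound\<close>.\<close>
proof (rule gap_lower_bound[of "1/4" 7 \<epsilon>])
  fix n\<^sub>0
  assume bound: "\<And>n N f \<mu>. \<lbrakk>n\<^sub>0 \<le> n; N < n; \<And>i j. i \<le> j \<Longrightarrow> j \<le> N \<Longrightarrow> f j \<le> f i; 0 \<le> f N; 0 < f 0; 0 \<le> \<mu>;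
    \<And>u l. u \<le> l \<Longrightarrow> l \<le> N \<Longrightarrow> f u - f l \<le> \<mu> * (\<Sum>j\<le>l. f j) * (1/4 * (real l - real u) + 7);
    f N \<le> \<mu> * (\<Sum>j\<le>N. f j)\<rbrakk> \<Longrightarrow> pi\<^sup>2 / (4 * (1/4)) - \<epsilon> \<le> (real n)\<^sup>2 * \<mu>"
  show thesis
  proof (rule that[of n\<^sub>0])
    fix n E f \<mu> N
    assume n: "n\<^sub>0 \<le> n" and "perron_ordered_graph n E f 4 \<mu> N"
    then interpret perron_ordered_graph n E f 4 \<mu> N by simp
    have "pi\<^sup>2 / (4 * (1/4)) - \<epsilon> \<le> (real n)\<^sup>2 * \<mu>"
    proof (rule bound[of n N f \<mu>])
      fix u l assume "u \<le> l" "l \<le> N"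
      interpret quartic_cut_profile l "\<lambda>v. card (earlier v)" "\<lambda>v. card (later v)" "\<lambda>k. card (cut k)"
        "\<lambda>v. card (skip v)" f "\<mu> * (\<Sum>j\<le>l. f j)"
        unfolding quartic_cut_profile_def by (rule cut_profile[OF \<open>l \<le> N\<close>])
      show "f u - f l \<le> \<mu> * (\<Sum>j\<le>l. f j) * (1/4 * (real l - real u) + 7)"
        using drop_bound[OF \<open>u \<le> l\<close>] by simp
    qed (use n N_less f_antimono f_nonneg f_0 \<mu>_nonneg end_value in auto)
    then show "pi\<^sup>2 - \<epsilon> \<le> (real n)\<^sup>2 * \<mu>" by simp
  qed
qed (use assms in auto)

section \<open>The Perron vector of a graph\<close>

text \<open>The quadratic form attains its maximum \<open>M\<close> on the unit sphere. Absolute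
  values of a maximiser do not lower the form, as the entries of \<open>A\<close> are nonnegative,
  and the first-order condition at the maximum is the eigenvalue equation.\<close>

lemma perron_vector:
  fixes A :: "nat \<Rightarrow> nat \<Rightarrow> real"
  assumes n: "0 < n" and sym: "\<And>i j. A i j = A j i" and nonneg: "\<And>i j. 0 \<le> A i j"
  obtains M x where "\<And>i. 0 \<le> x i" "\<exists>i<n. x i \<noteq> 0"
    "\<And>i. i < n \<Longrightarrow> (\<Sum>j<n. A i j * x j) = M * x i"
    "\<And>y. (\<Sum>i<n. \<Sum>j<n. A i j * y i * y j) \<le> M * (\<Sum>i<n. (y i)\<^sup>2)"
proof -
  define q where "q y = (\<Sum>i<n. \<Sum>j<n. A i j * y i * y j)" for y :: "nat \<Rightarrow> real"
  \<comment> \<open>Vectors are functions on all naturals that vanish from \<open>n\<close> on, so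
    that \<open>K\<close> is a product of compact sets and Tychonoff's theorem applies.\<close>
  define K :: "(nat \<Rightarrow> real) set" where "K = Pi\<^sub>E UNIV (\<lambda>i. if i < n then {-1..1} else {0})"
  define S where "S = K \<inter> {x. (\<Sum>i<n. (x i)\<^sup>2) = 1}"
  have coord: "continuous_on T (\<lambda>x. x i :: real)" for i :: nat and T
    by (rule continuous_on_subset[OF continuous_on_product_coordinates]) simp
  have "compactin (product_topology (\<lambda>i. euclidean) UNIV) K"
    unfolding K_def by (subst compactin_PiE) auto
  then have "compact K" by (simp add: euclidean_product_topology)
  moreover have "closed {x :: nat \<Rightarrow> real. (\<Sum>i<n. (x i)\<^sup>2) = 1}"
    by (intro closed_Collect_eq continuous_intros coord)
  ultimately have "compact S" unfolding S_def by (rule compact_Int_closed)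
  moreover have "(\<lambda>i. if i = 0 then 1 else 0) \<in> S"
  proof -
    have "(\<Sum>i<n. (if i = 0 then 1 else 0 :: real)\<^sup>2) = (\<Sum>i<n. if i = 0 then 1 else 0)"
      by (intro sum.cong) auto
    then show ?thesis using n by (auto simp: S_def K_def)
  qed
  moreover have "continuous_on S q"
    unfolding q_def by (intro continuous_intros coord)
  ultimately obtain x0 where x0: "x0 \<in> S" "\<And>y. y \<in> S \<Longrightarrow> q y \<le> q x0"
    using continuous_attains_sup[of S q] by blast
  define M where "M = q x0"
  have bound: "q y \<le> M * (\<Sum>i<n. (y i)\<^sup>2)" for y
  proof (cases "(\<Sum>i<n. (y i)\<^sup>2) = 0")
    case True
    then have "\<And>i. i < n \<Longrightarrow> y i = 0" by (subst (asm) sum_nonneg_eq_0_iff) auto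
    then show ?thesis using True by (simp add: q_def)
  next
    case False
    define s where "s = (\<Sum>i<n. (y i)\<^sup>2)"
    have s: "0 < s" using False by (simp add: s_def order.not_eq_order_implies_strict sum_nonneg)
    define z where "z i = (if i < n then y i / sqrt s else 0)" for i
    have sq: "(\<Sum>i<n. (z i)\<^sup>2) = 1"
      using s by (simp add: z_def power_divide s_def flip: sum_divide_distrib)
    have "z i \<in> {-1..1}" if "i < n" for i
    proof -
      have "(z i)\<^sup>2 \<le> 1" using member_le_sum[of i "{..<n}" "\<lambda>i. (z i)\<^sup>2"] that sq by simp
      then show ?thesis by (simp add: abs_square_le_1 abs_le_iff)
    qed
    then have "z \<in> S" using sq by (auto simp: S_def K_def z_def)
    then have "q z \<le> M" using x0 by (simp add: M_def)
    moreover have "q z = q y / s"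
      unfolding q_def sum_divide_distrib using s
      by (intro sum.cong) (auto simp: z_def power2_eq_square[symmetric])
    ultimately show ?thesis using s by (simp add: s_def field_simps)
  qed
  define x where "x i = \<bar>x0 i\<bar>" for i
  have x_sq: "(\<Sum>i<n. (x i)\<^sup>2) = 1" using x0 by (simp add: x_def S_def)
  have "q x0 \<le> q x"
    unfolding q_def x_def
  proof (intro sum_mono)
    fix i j
    have "A i j * (x0 i * x0 j) \<le> A i j * \<bar>x0 i * x0 j\<bar>" by (intro mult_left_mono nonneg) auto
    then show "A i j * x0 i * x0 j \<le> A i j * \<bar>x0 i\<bar> * \<bar>x0 j\<bar>" by (simp add: abs_mult mult.assoc)
  qed
  then have q_x: "q x = M" using bound[of x] x_sq by (simp add: M_def)
  have eigen: "(\<Sum>j<n. A i j * x j) = M * x i" if i: "i < n" for i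
  proof -
    define d where "d = M * x i - (\<Sum>j<n. A i j * x j)"
    define e where "e j = (if j = i then 1 else 0 :: real)" for j
    \<comment> \<open>The Rayleigh bound along the line \<open>x + t * e\<close>, with equality at t
      = 0; a nonzero residual \<open>d\<close> would violate it for small \<open>t\<close> of the
      opposite sign.\<close>
    have quad: "0 \<le> 2 * t * d + t\<^sup>2 * (M - A i i)" for t
    proof -
      have e_sum: "(\<Sum>j<n. g j * e j) = g i" for g :: "nat \<Rightarrow> real"
        
      proof -
        have "(\<Sum>j<n. g j * e j) = (\<Sum>j<n. if j = i then g j else 0)"
          by (intro sum.cong) (auto simp: e_def)
        then show ?thesis using i by simp
      qed
      have e_sum2: "(\<Sum>j<n. e j * g j) = g i" for g :: "nat \<Rightarrow> real"
        using e_sum[of g] by (simp add: mult.commute)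
      have norm: "(\<Sum>j<n. (x j + t * e j)\<^sup>2) = 1 + 2 * t * x i + t\<^sup>2"
      proof -
        have "(\<Sum>j<n. (x j + t * e j)\<^sup>2) = (\<Sum>j<n. (x j)\<^sup>2 + (2 * t * x j) * e j + (t\<^sup>2 * e j) * e j)"
          by (intro sum.cong) (auto simp: power2_eq_square algebra_simps)
        also have "\<dots> = 1 + 2 * t * x i + t\<^sup>2 * e i" by (simp only: sum.distrib e_sum x_sq)
        finally show ?thesis by (simp add: e_def)
      qed
      have "q (\<lambda>j. x j + t * e j) = (\<Sum>k<n. \<Sum>j<n. A k j * x k * x j + (t * A k j * x k) * e j
          + e k * (t * A k j * x j) + e k * ((t\<^sup>2 * A k j) * e j))"
        unfolding q_def by (intro sum.cong) (auto simp: power2_eq_square algebra_simps)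
      also have "\<dots> = (\<Sum>k<n. (\<Sum>j<n. A k j * x k * x j) + t * A k i * x k + e k * (\<Sum>j<n. t * A k j * x j)
          + e k * (t\<^sup>2 * A k i))"
        by (simp only: sum.distrib sum_distrib_left[symmetric] e_sum)
      also have "\<dots> = q x + (\<Sum>k<n. t * A k i * x k) + (\<Sum>k<n. e k * (\<Sum>j<n. t * A k j * x j))
          + (\<Sum>k<n. e k * (t\<^sup>2 * A k i))"
        by (simp only: sum.distrib q_def)
      also have "\<dots> = q x + (\<Sum>k<n. t * A k i * x k) + (\<Sum>j<n. t * A i j * x j) + t\<^sup>2 * A i i"
        by (simp only: e_sum2)
      also have "\<dots> = M + 2 * t * (\<Sum>j<n. A i j * x j) + t\<^sup>2 * A i i"

      proof -
        have "(\<Sum>k<n. t * A k i * x k) = (\<Sum>j<n. t * A i j * x j)"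
          using sym by (intro sum.cong) auto
        moreover have "(\<Sum>j<n. t * A i j * x j) = t * (\<Sum>j<n. A i j * x j)"
          by (simp only: sum_distrib_left mult.assoc)
        ultimately show ?thesis by (simp add: q_x)
      qed
      finally have "M + 2 * t * (\<Sum>j<n. A i j * x j) + t\<^sup>2 * A i i \<le> M * (1 + 2 * t * x i + t\<^sup>2)"
        using bound[of "\<lambda>j. x j + t * e j"] norm by simp
      then show ?thesis by (simp add: d_def algebra_simps)
    qed
    have "d = 0"
    proof (rule ccontr)
      assume d: "d \<noteq> 0"
      define b where "b = \<bar>M - A i i\<bar> + 1"
      have b: "0 < b" "M - A i i \<le> b" by (auto simp: b_def)
      have "0 \<le> 2 * (- d / b) * d + (- d / b)\<^sup>2 * (M - A i i)" by (rule quad)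
      also have "\<dots> \<le> 2 * (- d / b) * d + (- d / b)\<^sup>2 * b"
        using b by (intro add_left_mono mult_left_mono) auto
      also have "\<dots> = - (d\<^sup>2 / b)" using b by (simp add: power2_eq_square field_simps)
      also have "\<dots> < 0" using b d by simp
      finally show False by simp
    qed
    then show ?thesis by (simp add: d_def)
  qed
  show thesis
  proof (rule that[of x M])
    show "\<exists>i<n. x i \<noteq> 0" 
    proof (rule ccontr)
      assume "\<not> ?thesis"
      then have "(\<Sum>i<n. (x i)\<^sup>2) = 0" by (intro sum.neutral) auto
      then show False using x_sq by simp
    qed
  qed (use eigen bound in \<open>auto simp: x_def q_def\<close>)
qed

text \<open>The maximum \<open>M\<close> of the quadratic form is an eigenvalue and dominates all
  others by the Rayleigh bound; the spectrum being finite, it is the \<open>Max\<close> defining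
  \<open>lambda1\<close>.\<close>

lemma lambda1_perron:
  assumes G: "pair_graph G" "pverts G = {..<n}" and n: "0 < n"
  obtains x where "\<And>i. 0 \<le> x i" "\<exists>i<n. x i \<noteq> 0"
    "\<And>i. i < n \<Longrightarrow> (\<Sum>j | (i, j) \<in> parcs G. x j) = lambda1 G * x i"
    "\<And>y. (\<Sum>(i, j) \<in> parcs G. y i * y j) \<le> lambda1 G * (\<Sum>i<n. (y i)\<^sup>2)"
proof -
  interpret pair_graph G by fact
  define A where "A i j = (if (i, j) \<in> parcs G then 1 else 0 :: real)" for i j
  have sym: "A i j = A j i" for i j by (auto simp: A_def dest: arcs_symmetric)
  have arcs: "parcs G \<subseteq> {..<n} \<times> {..<n}" using in_arcsD1 in_arcsD2 G by auto
  obtain M x where x: "\<And>i. 0 \<le> x i" "\<exists>i<n. x i \<noteq> 0"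
    "\<And>i. i < n \<Longrightarrow> (\<Sum>j<n. A i j * x j) = M * x i"
    "\<And>y. (\<Sum>i<n. \<Sum>j<n. A i j * y i * y j) \<le> M * (\<Sum>i<n. (y i)\<^sup>2)"
  proof (rule perron_vector[of n A])
    show "0 \<le> A i j" for i j by (simp add: A_def)
  qed (use n sym in auto)
  have dim: "adjacency_matrix G \<in> carrier_mat n n" by (simp add: adjacency_matrix_def G)
  have mult: "(adjacency_matrix G *\<^sub>v v) $ i = (\<Sum>j<n. A i j * v $ j)" if "i < n" "v \<in> carrier_vec n" for i v
    using that by (auto simp: adjacency_matrix_def G scalar_prod_def A_def lessThan_atLeast0 intro!: sum.cong)
  have "eigenvalue (adjacency_matrix G) M"
  proof -
    have "vec n x \<noteq> 0\<^sub>v n" using x(2) by (metis index_vec index_zero_vec(1))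
    moreover have "adjacency_matrix G *\<^sub>v vec n x = M \<cdot>\<^sub>v vec n x"
    proof (rule eq_vecI)
      fix i assume "i < dim_vec (M \<cdot>\<^sub>v vec n x)"
      then have i: "i < n" by simp
      then show "(adjacency_matrix G *\<^sub>v vec n x) $ i = (M \<cdot>\<^sub>v vec n x) $ i"
        using mult[OF i, of "vec n x"] x(3)[OF i] by simp
    qed (use dim in auto)
    ultimately have "eigenvector (adjacency_matrix G) (vec n x) M"
      using dim by (auto simp: eigenvector_def)
    then show ?thesis by (auto simp: eigenvalue_def)
  qed
  moreover have "k \<le> M" if k: "eigenvalue (adjacency_matrix G) k" for k
  proof -
    obtain v where v: "v \<in> carrier_vec n" "v \<noteq> 0\<^sub>v n" "adjacency_matrix G *\<^sub>v v = k \<cdot>\<^sub>v v"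
      using k dim by (auto simp: eigenvalue_def eigenvector_def)
    have ev: "(\<Sum>j<n. A i j * v $ j) = k * v $ i" if "i < n" for i
      using mult[OF that v(1)] v that by auto
    have "k * (\<Sum>i<n. (v $ i)\<^sup>2) = (\<Sum>i<n. v $ i * (\<Sum>j<n. A i j * v $ j))"
      by (simp add: ev sum_distrib_left power2_eq_square mult_ac)
    also have "\<dots> = (\<Sum>i<n. \<Sum>j<n. A i j * v $ i * v $ j)"
      by (simp add: sum_distrib_left mult_ac)
    also have "\<dots> \<le> M * (\<Sum>i<n. (v $ i)\<^sup>2)" by (rule x(4))
    finally have "k * (\<Sum>i<n. (v $ i)\<^sup>2) \<le> M * (\<Sum>i<n. (v $ i)\<^sup>2)" .
    moreover have "0 < (\<Sum>i<n. (v $ i)\<^sup>2)"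
    proof -
      obtain i where "i < n" "v $ i \<noteq> 0" using v by (metis carrier_vecD eq_vecI index_zero_vec)
      then show ?thesis by (intro sum_pos2[of _ i]) auto
    qed
    ultimately show ?thesis by simp
  qed
  moreover have "finite {k. eigenvalue (adjacency_matrix G) k}"
    using card_finite_spectrum(1)[OF dim] by (simp add: spectrum_def)
  ultimately have M: "lambda1 G = M" unfolding lambda1_def by (intro Max_eqI) auto
  have nb: "(\<Sum>j<n. A i j * h j) = (\<Sum>j | (i, j) \<in> parcs G. h j)" for i and h :: "nat \<Rightarrow> real"
  proof -
    have "(\<Sum>j<n. A i j * h j) = (\<Sum>j<n. if (i, j) \<in> parcs G then h j else 0)"
      by (intro sum.cong) (auto simp: A_def)
    also have "\<dots> = (\<Sum>j | (i, j) \<in> parcs G. h j)"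
      using arcs by (subst sum.If_cases) (auto intro!: sum.cong)
    finally show ?thesis .
  qed
  have "(\<Sum>(i, j) \<in> parcs G. y i * y j) = (\<Sum>i<n. \<Sum>j<n. A i j * y i * y j)" for y
  proof -
    have "(\<Sum>(i, j) \<in> parcs G. y i * y j) = (\<Sum>(i, j) \<in> {..<n} \<times> {..<n}. A i j * y i * y j)"
      using arcs by (intro sum.mono_neutral_cong_left) (auto simp: A_def)
    then show ?thesis by (simp add: sum.cartesian_product)
  qed
  then show thesis using that[of x] x M nb by auto
qed

lemma out_degree_with_proj: "out_degree (with_proj G) v = card {w. (v, w) \<in> parcs G}"
proof -
  have "out_arcs (with_proj G) v = Pair v ` {w. (v, w) \<in> parcs G}"
    by (auto simp: out_arcs_def)
  then show ?thesis by (simp add: out_degree_def card_image inj_on_def)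
qed

text \<open>\<open>connected\<close> means strong connectivity of the symmetric closure, and the
  arcs here are already symmetric.\<close>

lemma connected_with_proj_iff:
  assumes "pair_graph G"
  shows "Digraph_Component.connected (with_proj G) \<longleftrightarrow>
    pverts G \<noteq> {} \<and> (\<forall>u\<in>pverts G. \<forall>v\<in>pverts G. (u, v) \<in> (parcs G)\<^sup>*)"
proof -
  interpret pair_graph G by fact
  have "reachable (with_proj G) u v \<longleftrightarrow> (u, v) \<in> (parcs G)\<^sup>*" if "u \<in> pverts G" for u v
  proof
    assume "reachable (with_proj G) u v"
    then show "(u, v) \<in> (parcs G)\<^sup>*" using reachable_rtranclI[of "with_proj G"] by simp
  next
    assume "(u, v) \<in> (parcs G)\<^sup>*"
    then show "reachable (with_proj G) u v"
      by induction (use that reachable_adj_trans in auto)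
  qed
  then show ?thesis
    using reachable_mk_symmetric_eq[OF sym_arcs]
    by (auto simp: Digraph_Component.connected_def strongly_connected_def mk_symmetric_def)
qed

text \<open>Vertices are sorted by decreasing Perron entry, and the graph is carried along the
  sorting permutation \<open>p\<close>.\<close>

lemma nonregular_graph_ordering:
  assumes "G \<in> nonregular_graphs n D"
  obtains E f N where "perron_ordered_graph n E f D (D - lambda1 G) N"
proof -
  have G: "pair_graph G" "pverts G = {..<n}" "Digraph_Component.connected (with_proj G)"
    "\<not> regular_graph G" "max_degree G = D"
    using assms by (auto simp: nonregular_graphs_def)
  interpret pair_graph G by fact
  have reach: "pverts G \<noteq> {}" "\<And>u v. u < n \<Longrightarrow> v < n \<Longrightarrow> (u, v) \<in> (parcs G)\<^sup>*"
    using connected_with_proj_iff[OF G(1)] G(2,3) by auto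
  then have n: "0 < n" using G by auto
  obtain x where x: "\<And>i. 0 \<le> x i" "\<exists>i<n. x i \<noteq> 0"
    "\<And>i. i < n \<Longrightarrow> (\<Sum>j | (i, j) \<in> parcs G. x j) = lambda1 G * x i"
    using lambda1_perron[OF G(1,2) n] by metis
  have arcs: "i < n" "j < n" if "(i, j) \<in> parcs G" for i j
    using in_arcsD1 in_arcsD2 that G by auto
  define d where "d v = card {w. (v, w) \<in> parcs G}" for v
  have d_le: "d v \<le> D" if "v < n" for v
  proof -
    have "out_degree (with_proj G) v \<le> max_degree G"
      unfolding max_degree_def using that G by (intro Max_ge) auto
    then show ?thesis by (simp add: out_degree_with_proj d_def G)
  qed
  have "\<exists>v<n. d v < D"
  proof (rule ccontr)
    assume "\<not> ?thesis"
    then have "d v = D" if "v < n" for v using d_le that by force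
    then have "regular_graph G" using G by (simp add: regular_graph_def out_degree_with_proj d_def)
    then show False using G by simp
  qed
  then obtain v where v: "v < n" "d v < D" by blast
  define xs where "xs = sort_key (\<lambda>i. - x i) [0..<n]"
  define p where "p i = xs ! i" for i
  have xs: "length xs = n" "distinct xs" "set xs = {..<n}" "sorted (map (\<lambda>i. - x i) xs)"
    by (auto simp: xs_def)
  have p: "bij_betw p {..<n} {..<n}"
    unfolding p_def using xs by (intro bij_betw_nth) auto
  have p_less: "p i < n" if "i < n" for i using p that by (auto simp: bij_betw_def)
  have p_inv: "\<exists>i<n. p i = w" if "w < n" for w
    using that bij_betw_imp_surj_on[OF p] by (metis imageE lessThan_iff)
  have p_inj: "i = j" if "p i = p j" "i < n" "j < n" for i j
    using p that by (auto simp: bij_betw_def inj_on_def)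
  define E where "E i j \<longleftrightarrow> i < n \<and> j < n \<and> (p i, p j) \<in> parcs G" for i j
  define f where "f i = x (p i)" for i
  have nb: "bij_betw p {j. E i j} {w. (p i, w) \<in> parcs G}" if "i < n" for i
  proof (rule bij_betw_imageI)
    show "inj_on p {j. E i j}" using p_inj by (auto simp: inj_on_def E_def)
    show "p ` {j. E i j} = {w. (p i, w) \<in> parcs G}"
      using that arcs p_inv by (auto simp: E_def image_iff) metis
  qed
  have deg: "card {j. E i j} = d (p i)" if "i < n" for i
    using bij_betw_same_card[OF nb[OF that]] by (simp add: d_def)
  define N where "N = (LEAST i. i < n \<and> d (p i) < D)"
  have "\<exists>i. i < n \<and> d (p i) < D" using v p_inv[of v] by auto
  then have N: "N < n" "d (p N) < D" unfolding N_def by (metis (mono_tags, lifting) LeastI)+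
  have before_N: "d (p i) = D" if "i < N" for i
  proof -
    have "\<not> (i < n \<and> d (p i) < D)" using that not_less_Least unfolding N_def by blast
    then show ?thesis using that N d_le[of "p i"] p_less[of i] by simp
  qed
  have antimono: "f j \<le> f i" if "i \<le> j" "j < n" for i j
    using sorted_nth_mono[OF xs(4), of i j] that xs by (simp add: f_def p_def)
  have "perron_ordered_graph n E f D (D - lambda1 G) N"
  proof
    show "E i j \<Longrightarrow> i < n \<and> j < n" for i j by (simp add: E_def)
    show "E i j \<Longrightarrow> E j i" for i j by (auto simp: E_def intro: arcs_symmetric)
    show "\<not> E i i" for i using no_loops' by (auto simp: E_def)
    show "i \<le> j \<Longrightarrow> j < n \<Longrightarrow> f j \<le> f i" for i j by (rule antimono)
    show "i < n \<Longrightarrow> 0 \<le> f i" for i by (simp add: f_def x)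
    show "0 < f 0"
    proof -
      obtain w where "w < n" "x w \<noteq> 0" using x(2) by blast
      then obtain i where "i < n" "f i \<noteq> 0" using p_inv[of w] by (auto simp: f_def)
      then show ?thesis using antimono[of 0 i] x(1)[of "p i"] by (simp add: f_def)
    qed
    show "(\<Sum>j | E i j. f j) = (real D - (real D - lambda1 G)) * f i" if "i < n" for i
      using sum.reindex_bij_betw[OF nb[OF that], of x] x(3)[OF p_less[OF that]] by (simp add: f_def)
    show "i < n \<Longrightarrow> card {j. E i j} \<le> D" for i by (simp add: deg d_le p_less)
    show "N < n" by fact
    show "card {j. E N j} < D" using deg N by simp
    show "i < N \<Longrightarrow> card {j. E i j} = D" for i using deg before_N N by simp
    show "\<exists>i j. i < k \<and> k \<le> j \<and> E i j" if k: "0 < k" "k < n" for k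
    proof (rule ccontr)
      assume no_edge: "\<not> ?thesis"
      have "(p 0, p k) \<in> (parcs G)\<^sup>*" using reach p_less k by simp
      then have "p k \<in> p ` {..<k}"
      proof induction
        case (step u w)
        then obtain i where i: "i < k" "u = p i" by auto
        obtain j where j: "j < n" "w = p j" using arcs(2)[OF step(2)] p_inv by metis
        then have "E i j" using i step k by (simp add: E_def)
        then show ?case using no_edge i j by (metis image_eqI lessThan_iff not_le)
      qed (use k in auto)
      then obtain i where "i < k" "p k = p i" by auto
      then show False using p_inj[of k i] k by simp
    qed
  qed
  then show thesis by (rule that)
qed

lemma finite_nonregular_graphs: "finite (nonregular_graphs n D)"
proof (rule finite_subset)
  show "nonregular_graphs n D \<subseteq> (\<lambda>A. \<lparr>pverts = {..<n}, parcs = A\<rparr>) ` Pow ({..<n} \<times> {..<n})"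
  proof
    fix G assume G: "G \<in> nonregular_graphs n D"
    then interpret pair_graph G by (simp add: nonregular_graphs_def)
    have "pverts G = {..<n}" using G by (simp add: nonregular_graphs_def)
    then have "parcs G \<in> Pow ({..<n} \<times> {..<n})" "G = \<lparr>pverts = {..<n}, parcs = parcs G\<rparr>"
      using in_arcsD1 in_arcsD2 by auto
    then show "G \<in> (\<lambda>A. \<lparr>pverts = {..<n}, parcs = A\<rparr>) ` Pow ({..<n} \<times> {..<n})" by (rule rev_image_eqI)
  qed
qed simp

section \<open>Long chains of small blocks\<close>

text \<open>A single infinite chain, cut off after \<open>n\<close> vertices, serves all
  \<open>n\<close> at once, without cases modulo the block length.\<close>

definition initial_graph :: "(nat \<Rightarrow> nat \<Rightarrow> bool) \<Rightarrow> nat \<Rightarrow> nat pair_pre_digraph" where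
  "initial_graph R n = \<lparr>pverts = {..<n}, parcs = {(i, j). i < n \<and> j < n \<and> R i j}\<rparr>"

lemma sum_blocks:
  fixes g :: "nat \<Rightarrow> real"
  shows "(\<Sum>v<k + B * q. g v) = (\<Sum>v<k. g v) + (\<Sum>t<q. \<Sum>j<B. g (k + B * t + j))"
proof (induction q)
  case (Suc q)
  have "(\<Sum>v<m + B. g v) = (\<Sum>v<m. g v) + (\<Sum>j<B. g (m + j))" for m
    by (induction B) (simp_all add: add.assoc)
  from this[of "k + B * q"] have "(\<Sum>v<k + B * Suc q. g v) = (\<Sum>v<k + B * q. g v) + (\<Sum>j<B. g (k + B * q + j))"
    by (simp add: algebra_simps)
  then show ?case by (simp add: Suc)
qed simp

text \<open>Reflecting \<open>t\<close> to \<open>q - t\<close> exchanges the squares of cosine and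
  sine, so both sums are half of the total.\<close>

lemma sum_reflect_cos_sq:
  fixes q :: nat
  assumes "0 < q"
  shows "(\<Sum>t\<le>q. (cos (pi / (2 * q) * t))\<^sup>2) = (real q + 1) / 2"
proof -
  let ?S = "\<Sum>t\<le>q. (cos (pi / (2 * q) * t))\<^sup>2"
  have "?S = (\<Sum>t\<le>q. (cos (pi / (2 * q) * real (q - t)))\<^sup>2)"
    by (rule sum.reindex_bij_witness[of _ "\<lambda>t. q - t" "\<lambda>t. q - t"]) auto
  also have "\<dots> = (\<Sum>t\<le>q. (sin (pi / (2 * q) * t))\<^sup>2)"
  proof (rule sum.cong[OF refl])
    fix t assume "t \<in> {..q}"
    then have "pi / (2 * q) * real (q - t) = pi / 2 - pi / (2 * q) * t"
      using assms by (simp add: of_nat_diff field_simps)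
    then show "(cos (pi / (2 * q) * real (q - t)))\<^sup>2 = (sin (pi / (2 * q) * t))\<^sup>2"
      by (simp add: cos_diff)
  qed
  finally have eq: "?S = (\<Sum>t\<le>q. (sin (pi / (2 * q) * t))\<^sup>2)" .
  have "?S + (\<Sum>t\<le>q. (sin (pi / (2 * q) * t))\<^sup>2) = real q + 1"
    unfolding sum.distrib[symmetric] by simp
  then show ?thesis unfolding eq[symmetric] by simp
qed

lemma sum_reflect_sin_sq:
  fixes q :: nat
  assumes "0 < q"
  shows "(\<Sum>t<q. (sin (pi / (2 * q) * (t + 1/2)))\<^sup>2) = q / 2"
proof -
  let ?S = "\<Sum>t<q. (sin (pi / (2 * q) * (t + 1/2)))\<^sup>2"
  have "?S = (\<Sum>t<q. (sin (pi / (2 * q) * (real (q - Suc t) + 1/2)))\<^sup>2)"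
    by (rule sum.reindex_bij_witness[of _ "\<lambda>t. q - Suc t" "\<lambda>t. q - Suc t"]) auto
  also have "\<dots> = (\<Sum>t<q. (cos (pi / (2 * q) * (t + 1/2)))\<^sup>2)"
  proof (rule sum.cong[OF refl])
    fix t assume "t \<in> {..<q}"
    then have "pi / (2 * q) * (real (q - Suc t) + 1/2) = pi / 2 - pi / (2 * q) * (t + 1/2)"
      using assms by (simp add: of_nat_diff field_simps)
    then show "(sin (pi / (2 * q) * (real (q - Suc t) + 1/2)))\<^sup>2 = (cos (pi / (2 * q) * (t + 1/2)))\<^sup>2"
      by (simp add: sin_diff)
  qed
  finally have eq: "?S = (\<Sum>t<q. (cos (pi / (2 * q) * (t + 1/2)))\<^sup>2)" .
  have "?S + (\<Sum>t<q. (cos (pi / (2 * q) * (t + 1/2)))\<^sup>2) = real q"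
    unfolding sum.distrib[symmetric] by simp
  then show ?thesis unfolding eq[symmetric] by simp
qed

locale regular_chain =
  fixes R :: "nat \<Rightarrow> nat \<Rightarrow> bool" and D :: nat
  assumes R_sym: "R v w \<Longrightarrow> R w v" and R_irrefl: "\<not> R v v" and R_Suc: "R v (Suc v)"
    and R_near: "R v w \<Longrightarrow> w \<le> v + 4" and R_card: "card {w. R v w} = D"
begin

lemma finite_R: "finite {w. R v w}"
  by (rule finite_subset[of _ "{..v + 4}"]) (auto dest: R_near)

lemma pair_graph_initial: "pair_graph (initial_graph R n)"
proof
  show "finite (parcs (initial_graph R n))"
    by (rule finite_subset[of _ "{..<n} \<times> {..<n}"]) (auto simp: initial_graph_def)
  show "symmetric (with_proj (initial_graph R n))"
    using R_sym by (auto simp: symmetric_def initial_graph_def intro: symI)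
qed (auto simp: initial_graph_def R_irrefl)

lemma degree_initial:
  assumes "v < n"
  shows "out_degree (with_proj (initial_graph R n)) v = card {w. w < n \<and> R v w}"
  using assms by (auto simp: out_degree_with_proj initial_graph_def intro!: arg_cong[of _ _ card])

lemma degree_inner:
  assumes "v + 4 < n"
  shows "card {w. w < n \<and> R v w} = D"
proof -
  have "{w. w < n \<and> R v w} = {w. R v w}" using assms by (auto dest: R_near)
  then show ?thesis by (simp add: R_card)
qed

text \<open>Consecutive vertices are adjacent, which gives connectedness. Vertex 0 keeps its full
  degree because \<open>5 \<le> n\<close>, while \<open>n - 1\<close> loses its neighbour
  \<open>n\<close>.\<close>

lemma initial_graph_nonregular:
  assumes n: "5 \<le> n"
  shows "initial_graph R n \<in> nonregular_graphs n D"
proof -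
  let ?G = "initial_graph R n"
  have path: "(i, i + m) \<in> (parcs ?G)\<^sup>*" if "i + m < n" for i m
    using that
  proof (induction m)
    case (Suc m)
    then have "(i + m, i + Suc m) \<in> parcs ?G" using R_Suc by (simp add: initial_graph_def)
    then show ?case using Suc by (auto intro: rtrancl_into_rtrancl)
  qed simp
  have sym: "sym ((parcs ?G)\<^sup>*)"
    using R_sym by (intro sym_rtrancl) (auto simp: sym_def initial_graph_def)
  have "(u, v) \<in> (parcs ?G)\<^sup>*" if "u < n" "v < n" for u v
  proof (cases "u \<le> v")
    case True
    then show ?thesis using path[of u "v - u"] that by simp
  next
    case False
    then show ?thesis using path[of v "u - v"] that sym by (auto dest: symD)
  qed
  moreover have "0 \<in> {..<n}" using n by simp
  ultimately have conn: "Digraph_Component.connected (with_proj ?G)"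
    by (subst connected_with_proj_iff[OF pair_graph_initial]) (auto simp: initial_graph_def)
  have le: "out_degree (with_proj ?G) v \<le> D" if "v < n" for v
    using card_mono[OF finite_R, of "{w. w < n \<and> R v w}" v] that by (auto simp: degree_initial R_card)
  have deg_0: "out_degree (with_proj ?G) 0 = D" using degree_inner[of 0] degree_initial[of 0] n by simp
  have deg_last: "out_degree (with_proj ?G) (n - 1) < D"
  proof -
    have "R (n - 1) n" using R_Suc[of "n - 1"] n by simp
    then have "{w. w < n \<and> R (n - 1) w} \<subset> {w. R (n - 1) w}" by auto
    then show ?thesis using psubset_card_mono[OF finite_R] degree_initial[of "n - 1" n] n by (simp add: R_card)
  qed
  have verts: "pverts ?G = {..<n}" by (simp add: initial_graph_def)
  have "max_degree ?G = D"
    unfolding max_degree_def verts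
  proof (rule Max_eqI)
    show "D \<in> out_degree (with_proj ?G) ` {..<n}" using deg_0 n by (intro image_eqI[of _ _ 0]) auto
  qed (use le in auto)
  moreover have "\<not> regular_graph ?G"
  proof
    assume "regular_graph ?G"
    then have "out_degree (with_proj ?G) 0 = out_degree (with_proj ?G) (n - 1)"
      using n unfolding regular_graph_def verts by simp
    then show False using deg_0 deg_last by simp
  qed
  ultimately show ?thesis using pair_graph_initial conn verts by (simp add: nonregular_graphs_def)
qed

text \<open>The test vector vanishes on the last four vertices, so it sees only vertices of full
  degree \<open>D\<close>, and \<open>D\<close> times its norm minus the quadratic form is the sum
  of squared differences over edges.\<close>

lemma rayleigh_initial:
  assumes n: "0 < n" and y: "\<And>v. y v \<noteq> 0 \<Longrightarrow> v + 4 < n"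
  shows "(D - lambda1 (initial_graph R n)) * (\<Sum>v<n. (y v)\<^sup>2) \<le>
    (\<Sum>v<n. \<Sum>w | w < v \<and> R w v. (y v - y w)\<^sup>2)"
proof -
  let ?G = "initial_graph R n"
  let ?A = "parcs ?G"
  have verts: "pverts ?G = {..<n}" by (simp add: initial_graph_def)
  obtain x where "\<And>y. (\<Sum>(i, j) \<in> ?A. y i * y j) \<le> lambda1 ?G * (\<Sum>i<n. (y i)\<^sup>2)"
    using lambda1_perron[OF pair_graph_initial verts n] by metis
  then have ray: "(\<Sum>(i, j) \<in> ?A. y i * y j) \<le> lambda1 ?G * (\<Sum>i<n. (y i)\<^sup>2)" .
  have A: "?A = (SIGMA i:{..<n}. {j. j < n \<and> R i j})" by (auto simp: initial_graph_def)
  have swap: "(\<Sum>(i, j) \<in> ?A. h j i) = (\<Sum>(i, j) \<in> ?A. h i j)" for h :: "nat \<Rightarrow> nat \<Rightarrow> real"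
    by (rule sum.reindex_bij_witness[of _ prod.swap prod.swap]) (auto simp: initial_graph_def intro: R_sym)
  have fst_sq: "(\<Sum>(i, j) \<in> ?A. (y i)\<^sup>2) = D * (\<Sum>i<n. (y i)\<^sup>2)"
  proof -
    have "(\<Sum>(i, j) \<in> ?A. (y i)\<^sup>2) = (\<Sum>i<n. \<Sum>j | j < n \<and> R i j. (y i)\<^sup>2)"
      unfolding A by (subst sum.Sigma) auto
    also have "\<dots> = (\<Sum>i<n. D * (y i)\<^sup>2)"
    proof (rule sum.cong[OF refl])
      fix i
      show "(\<Sum>j | j < n \<and> R i j. (y i)\<^sup>2) = D * (y i)\<^sup>2"
        using degree_inner[of i n] y[of i] by (cases "y i = 0") auto
    qed
    finally show ?thesis by (simp add: sum_distrib_left)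
  qed
  have energy: "(\<Sum>(i, j) \<in> ?A. (y i - y j)\<^sup>2) = 2 * (\<Sum>v<n. \<Sum>w | w < v \<and> R w v. (y v - y w)\<^sup>2)"
  proof -
    let ?L = "SIGMA v:{..<n}. {w. w < v \<and> R w v}"
    let ?U = "prod.swap ` ?L"
    have fin: "finite ?L" by (rule finite_subset[of _ "{..<n} \<times> {..<n}"]) auto
    have "?A = ?L \<union> ?U"
      using R_irrefl R_sym by (auto simp: initial_graph_def image_iff) (metis linorder_neqE_nat)
    then have "(\<Sum>(i, j) \<in> ?A. (y i - y j)\<^sup>2) = (\<Sum>(i, j) \<in> ?L. (y i - y j)\<^sup>2) + (\<Sum>(i, j) \<in> ?U. (y i - y j)\<^sup>2)"
      using fin by (simp only:) (rule sum.union_disjoint, auto)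
    also have "(\<Sum>(i, j) \<in> ?U. (y i - y j)\<^sup>2) = (\<Sum>(i, j) \<in> ?L. (y i - y j)\<^sup>2)"
      by (subst sum.reindex) (auto simp: inj_on_def power2_commute intro!: sum.cong)
    also have "(\<Sum>(i, j) \<in> ?L. (y i - y j)\<^sup>2) = (\<Sum>v<n. \<Sum>w | w < v \<and> R w v. (y v - y w)\<^sup>2)"
      by (subst sum.Sigma) auto
    finally show ?thesis by simp
  qed
  have "(\<Sum>(i, j) \<in> ?A. (y i - y j)\<^sup>2) =
      (\<Sum>(i, j) \<in> ?A. (y i)\<^sup>2) + (\<Sum>(i, j) \<in> ?A. (y j)\<^sup>2) - 2 * (\<Sum>(i, j) \<in> ?A. y i * y j)"
    unfolding sum_distrib_left sum.distrib[symmetric] sum_subtractf[symmetric]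
    by (intro sum.cong) (auto simp: power2_eq_square algebra_simps)
  also have "\<dots> = 2 * (D * (\<Sum>i<n. (y i)\<^sup>2)) - 2 * (\<Sum>(i, j) \<in> ?A. y i * y j)"
    using swap[of "\<lambda>i j. (y i)\<^sup>2"] fst_sq by simp
  finally show ?thesis using energy ray by (simp add: algebra_simps)
qed

end

text \<open>Constant on a cap of \<open>k\<close> vertices, then block \<open>t\<close> of length
  \<open>B\<close> interpolates from \<open>c t\<close> to \<open>c (Suc t)\<close>, with
  \<open>\<omega> j\<close> the fraction of the drop reached at its \<open>j\<close>-th
  vertex.\<close>

definition chain_profile :: "nat \<Rightarrow> nat \<Rightarrow> (nat \<Rightarrow> real) \<Rightarrow> (nat \<Rightarrow> real) \<Rightarrow> nat \<Rightarrow> real" where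
  "chain_profile k B \<omega> c v = (if v < k then c 0
    else c ((v - k) div B) - \<omega> ((v - k) mod B) * (c ((v - k) div B) - c (Suc ((v - k) div B))))"

text \<open>In both instances below, \<omega> is the harmonic potential of a block, so
  \<open>e\<close> is its effective conductance and 1 / (e B) the resistance per vertex.\<close>

locale block_chain = regular_chain +
  fixes k B :: nat and \<omega> :: "nat \<Rightarrow> real" and e :: real
  assumes B_pos: "0 < B" and e_nonneg: "0 \<le> e" and \<omega>: "0 \<le> \<omega> j" "\<omega> j \<le> 1"
    and cap_energy: "v < k \<Longrightarrow>
      (\<Sum>w | w < v \<and> R w v. (chain_profile k B \<omega> c v - chain_profile k B \<omega> c w)\<^sup>2) = 0"
    and block_energy: "(\<Sum>j<B. \<Sum>w | w < k + B * t + j \<and> R w (k + B * t + j).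
      (chain_profile k B \<omega> c (k + B * t + j) - chain_profile k B \<omega> c w)\<^sup>2) = e * (c t - c (Suc t))\<^sup>2"
begin

text \<open>A quarter period of the cosine, sampled at the joints of \<open>q\<close> blocks, has
  energy at most e \<theta>^2 q / 2 and squared norm at least B (q - 1) / 2; the bound is the
  quotient.\<close>

lemma lambda1_lower_bound:
  assumes q: "2 \<le> q" and n: "k + B * q + 4 \<le> n"
  shows "D - lambda1 (initial_graph R n) \<le> e * pi\<^sup>2 / (4 * B * q * (real q - 1))"
proof -
  define \<theta> where "\<theta> = pi / (2 * real q)"
  define c where "c t = (if t \<le> q then cos (\<theta> * t) else 0)" for t :: nat
  define y where "y = chain_profile k B \<omega> c"
  have \<theta>: "0 < \<theta>" "\<theta> * q = pi / 2" using q by (auto simp: \<theta>_def)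
  have arg: "\<theta> * t \<le> pi / 2" if "t \<le> q" for t :: nat
    using mult_left_mono[of "real t" "real q" \<theta>] \<theta> that by simp
  have "cos (\<theta> * q) = 0" unfolding \<theta>(2) by simp
  then have c_q: "c t = 0" if "q \<le> t" for t using that by (cases "t = q") (auto simp: c_def)
  have c_nonneg: "0 \<le> c t" for t
  proof (cases "t \<le> q")
    case True
    have "- (pi / 2) \<le> 0" "0 \<le> \<theta> * t" using \<theta> by auto
    then have "0 \<le> cos (\<theta> * t)" using arg[OF True] by (intro cos_ge_zero) linarith+
    then show ?thesis using True by (simp add: c_def)
  qed (simp add: c_def)
  have c_mono: "c (Suc t) \<le> c t" for t
  proof (cases "Suc t \<le> q")
    case True
    have "\<theta> * Suc t \<le> pi" using arg[OF True] pi_gt_zero by linarith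
    then have "cos (\<theta> * Suc t) \<le> cos (\<theta> * t)"
      using \<theta>(1) by (intro cos_monotone_0_pi_le mult_left_mono) auto
    then show ?thesis using True by (simp add: c_def)
  next
    case False
    then show ?thesis using c_nonneg c_q[of "Suc t"] by simp
  qed
  have block: "y (k + B * t + j) = c t - \<omega> j * (c t - c (Suc t))" if "j < B" for t j
    using that by (simp add: y_def chain_profile_def add.commute)
  have y_far: "y v = 0" if "k + B * q \<le> v" for v
  proof -
    have "q \<le> (v - k) div B" using that B_pos by (simp add: less_eq_div_iff_mult_less_eq mult.commute)
    then show ?thesis using that c_q by (simp add: y_def chain_profile_def)
  qed
  let ?X = "D - lambda1 (initial_graph R n)"
  let ?e = "\<lambda>v. \<Sum>w | w < v \<and> R w v. (y v - y w)\<^sup>2"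
  have qn: "q \<le> n" "n \<le> k + B * n" using n B_pos by (auto intro: order_trans[of _ "B * q"] trans_le_add2)
  \<comment> \<open>Padding to whole blocks makes \<open>sum_blocks\<close> applicable; blocks from
    \<open>q\<close> on have zero energy.\<close>
  have "(\<Sum>v<n. ?e v) \<le> (\<Sum>v<k + B * n. ?e v)"
    using qn by (intro sum_mono2 sum_nonneg) auto
  also have "\<dots> = (\<Sum>t<n. e * (c t - c (Suc t))\<^sup>2)"
    unfolding sum_blocks y_def by (simp add: cap_energy block_energy)
  also have "\<dots> = (\<Sum>t<q. e * (c t - c (Suc t))\<^sup>2)"
    using qn c_q by (intro sum.mono_neutral_right) auto
  also have "\<dots> \<le> (\<Sum>t<q. e * (\<theta>\<^sup>2 * (sin (\<theta> * (t + 1/2)))\<^sup>2))"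
  proof (intro sum_mono mult_left_mono e_nonneg)
    fix t assume t: "t \<in> {..<q}"
    have "c t - c (Suc t) = 2 * sin (\<theta> / 2) * sin (\<theta> * (t + 1/2))"
      using t by (simp add: c_def cos_diff_cos algebra_simps add_divide_distrib)
    then have "(c t - c (Suc t))\<^sup>2 = (2 * sin (\<theta> / 2))\<^sup>2 * (sin (\<theta> * (t + 1/2)))\<^sup>2"
      by (simp add: power_mult_distrib)
    also have "\<dots> \<le> \<theta>\<^sup>2 * (sin (\<theta> * (t + 1/2)))\<^sup>2"
    proof (rule mult_right_mono)
      have "\<bar>2 * sin (\<theta> / 2)\<bar> \<le> \<bar>\<theta>\<bar>" using abs_sin_x_le_abs_x[of "\<theta> / 2"] by (simp add: abs_mult)
      then show "(2 * sin (\<theta> / 2))\<^sup>2 \<le> \<theta>\<^sup>2" by (simp only: abs_le_square_iff)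
    qed simp
    finally show "(c t - c (Suc t))\<^sup>2 \<le> \<theta>\<^sup>2 * (sin (\<theta> * (t + 1/2)))\<^sup>2" .
  qed
  also have "\<dots> = e * \<theta>\<^sup>2 * q / 2"
    using sum_reflect_sin_sq[of q] q by (simp add: \<theta>_def flip: sum_distrib_left)
  finally have energy: "(\<Sum>v<n. ?e v) \<le> e * \<theta>\<^sup>2 * q / 2" .
  have "B * ((real q - 1) / 2) = (\<Sum>t<q. \<Sum>j<B. (c (Suc t))\<^sup>2)"
  proof -
    have "(\<Sum>t<q. (c (Suc t))\<^sup>2) = (\<Sum>t<q. (cos (\<theta> * Suc t))\<^sup>2)"
      by (intro sum.cong) (auto simp: c_def)
    also have "\<dots> = (\<Sum>t\<le>q. (cos (\<theta> * t))\<^sup>2) - 1"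
      by (subst sum.atMost_shift) simp
    also have "\<dots> = (real q - 1) / 2"
      using sum_reflect_cos_sq[of q] q by (simp add: \<theta>_def field_simps)
    finally show ?thesis by (simp flip: sum_distrib_left)
  qed
  also have "\<dots> \<le> (\<Sum>t<q. \<Sum>j<B. (y (k + B * t + j))\<^sup>2)"
  proof (intro sum_mono power_mono)
    fix t j assume "j \<in> {..<B}"
    moreover have "\<omega> j * (c t - c (Suc t)) \<le> 1 * (c t - c (Suc t))"
      using \<omega> c_mono[of t] by (intro mult_right_mono) auto
    ultimately show "c (Suc t) \<le> y (k + B * t + j)" by (simp add: block)
  qed (rule c_nonneg)
  also have "\<dots> \<le> (\<Sum>v<k + B * q. (y v)\<^sup>2)" unfolding sum_blocks by (simp add: sum_nonneg)
  also have "\<dots> \<le> (\<Sum>v<n. (y v)\<^sup>2)" using n by (intro sum_mono2) auto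
  finally have norm: "B * ((real q - 1) / 2) \<le> (\<Sum>v<n. (y v)\<^sup>2)" .
  have "?X * (\<Sum>v<n. (y v)\<^sup>2) \<le> (\<Sum>v<n. ?e v)"
  proof (rule rayleigh_initial)
    show "v + 4 < n" if "y v \<noteq> 0" for v using y_far[of v] that n by (cases "k + B * q \<le> v") auto
  qed (use n in simp)
  then have "?X * (\<Sum>v<n. (y v)\<^sup>2) \<le> e * \<theta>\<^sup>2 * q / 2" using energy by simp
  moreover have "?X * (B * ((real q - 1) / 2)) \<le> ?X * (\<Sum>v<n. (y v)\<^sup>2)" if "0 \<le> ?X"
    using norm that by (rule mult_left_mono)
  ultimately have bound: "?X * (B * ((real q - 1) / 2)) \<le> e * \<theta>\<^sup>2 * q / 2" if "0 \<le> ?X"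
    using that by linarith
  show ?thesis
  proof (cases "0 \<le> ?X")
    case True
    have "?X \<le> (e * \<theta>\<^sup>2 * q / 2) / (B * ((real q - 1) / 2))"
      using bound[OF True] q B_pos by (subst pos_le_divide_eq) auto
    also have "\<dots> = e * pi\<^sup>2 / (4 * B * q * (real q - 1))"
      using q B_pos by (simp add: \<theta>_def power2_eq_square field_simps)
    finally show ?thesis .
  next
    case False
    moreover have "0 \<le> e * pi\<^sup>2 / (4 * B * q * (real q - 1))"
      using q e_nonneg by (intro divide_nonneg_nonneg mult_nonneg_nonneg) auto
    ultimately show ?thesis by linarith
  qed
qed

end

text \<open>The cap on 0 to 4 is K_4 with the edge between 0 and 3 subdivided by 4. Block
  \<open>t\<close> is K_4 without the edge between its first and last vertex, on 5 + 4t to 8 + 4t,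
  entered by a bridge from 4 + 4t; \<open>(j + 3) mod 4\<close> is the position in the
  block.\<close>

definition cubic_edge :: "nat \<Rightarrow> nat \<Rightarrow> bool" where
  "cubic_edge i j \<longleftrightarrow> i + 1 = j \<or> i + 2 = j \<and> (if j < 5 then j < 4 else 2 \<le> (j + 3) mod 4) \<or> i = 0 \<and> j = 4"

definition cubic_chain :: "nat \<Rightarrow> nat \<Rightarrow> bool" where
  "cubic_chain i j \<longleftrightarrow> cubic_edge i j \<or> cubic_edge j i"

lemma cubic_chain_neighbours:
  "{w. cubic_chain v w} = (if v < 5 then [{1, 2, 4}, {0, 2, 3}, {0, 1, 3}, {1, 2, 4}, {0, 3, 5}] ! v
    else if (v + 3) mod 4 < 2 then {v - 1, v + 1, v + 2} else {v - 2, v - 1, v + 1})"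
proof (cases "v < 5")
  case True
  then consider "v = 0" | "v = 1" | "v = 2" | "v = 3" | "v = 4" by linarith
  then show ?thesis
    by cases (auto simp: cubic_chain_def cubic_edge_def split: if_splits)
next
  case False
  have "2 \<le> (v + 2 + 3) mod 4 \<longleftrightarrow> (v + 3) mod 4 < 2" by presburger
  then have "cubic_chain v w \<longleftrightarrow> w = v + 1 \<or> w + 1 = v \<or> w = v + 2 \<and> (v + 3) mod 4 < 2 \<or>
      w + 2 = v \<and> \<not> (v + 3) mod 4 < 2" for w
    unfolding cubic_chain_def cubic_edge_def using False by auto
  then have "{w. cubic_chain v w} = {w. w = v + 1 \<or> w + 1 = v \<or> w = v + 2 \<and> (v + 3) mod 4 < 2 \<or>
      w + 2 = v \<and> \<not> (v + 3) mod 4 < 2}" by (rule Collect_cong)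
  also have "\<dots> = (if (v + 3) mod 4 < 2 then {v - 1, v + 1, v + 2} else {v - 2, v - 1, v + 1})"
    using False by (cases "(v + 3) mod 4 < 2") auto
  finally show ?thesis using False by simp
qed

lemma cubic_chain_down: "{w. w < v \<and> cubic_chain w v} = {w. cubic_edge w v}"
  by (auto simp: cubic_chain_def cubic_edge_def split: if_splits)

lemma cubic_edge_block:
  "{w. cubic_edge w (5 + 4 * t)} = {4 + 4 * t}"
  "{w. cubic_edge w (6 + 4 * t)} = {5 + 4 * t}"
  "{w. cubic_edge w (7 + 4 * t)} = {5 + 4 * t, 6 + 4 * t}"
  "{w. cubic_edge w (8 + 4 * t)} = {6 + 4 * t, 7 + 4 * t}"
  by (auto simp: cubic_edge_def)

text \<open>The bridge and the rest of the block each have resistance 1, so half of the drop falls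
  on the bridge; the two middle vertices share the value halfway through the rest.\<close>

definition cubic_weight :: "nat \<Rightarrow> real" where
  "cubic_weight j = (if j = 0 then 1/2 else if j < 3 then 3/4 else 1)"

lemma chain_profile_block:
  "j < B \<Longrightarrow> chain_profile k B \<omega> c (k + B * t + j) = c t - \<omega> j * (c t - c (Suc t))"
  by (simp add: chain_profile_def add.commute)

text \<open>The vertex just before block \<open>t\<close> is the last one of the previous block, or
  of the cap, and carries the sampled value itself.\<close>

lemma chain_profile_joint:
  assumes "0 < k" "0 < B" "\<omega> (B - 1) = 1"
  shows "chain_profile k B \<omega> c (k - 1 + B * t) = c t"
proof (cases t)
  case 0
  then show ?thesis using assms by (simp add: chain_profile_def)
next
  case (Suc s)
  then have "k - 1 + B * t = k + B * s + (B - 1)" using assms by (simp add: algebra_simps)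
  then show ?thesis using assms Suc chain_profile_block[of "B - 1" B k \<omega> c s] by simp
qed

interpretation cubic: block_chain cubic_chain 3 5 4 cubic_weight "1/2"
proof
  show "cubic_chain v w \<Longrightarrow> cubic_chain w v" for v w by (auto simp: cubic_chain_def)
  show "\<not> cubic_chain v v" for v by (auto simp: cubic_chain_def cubic_edge_def)
  show "cubic_chain v (Suc v)" for v by (simp add: cubic_chain_def cubic_edge_def)
  show "cubic_chain v w \<Longrightarrow> w \<le> v + 4" for v w
    by (auto simp: cubic_chain_def cubic_edge_def split: if_splits)
  show "card {w. cubic_chain v w} = 3" for v
  proof (cases "v < 5")
    case True
    then consider "v = 0" | "v = 1" | "v = 2" | "v = 3" | "v = 4" by linarith
    then show ?thesis by cases (simp_all add: cubic_chain_neighbours)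
  qed (auto simp: cubic_chain_neighbours card_insert_if)
  show "0 \<le> cubic_weight j" "cubic_weight j \<le> 1" for j by (auto simp: cubic_weight_def)
  fix c :: "nat \<Rightarrow> real"
  let ?y = "chain_profile 5 4 cubic_weight c"
  show "(\<Sum>w | w < v \<and> cubic_chain w v. (?y v - ?y w)\<^sup>2) = 0" if "v < 5" for v
    using that by (intro sum.neutral) (auto simp: chain_profile_def)
  fix t
  have y: "?y (4 + 4 * t) = c t" "?y (5 + 4 * t) = c t - 1/2 * (c t - c (Suc t))"
    "?y (6 + 4 * t) = c t - 3/4 * (c t - c (Suc t))" "?y (7 + 4 * t) = c t - 3/4 * (c t - c (Suc t))"
    "?y (8 + 4 * t) = c (Suc t)"
    using chain_profile_joint[of 5 4 cubic_weight c t] chain_profile_block[of 0 4 5 cubic_weight c t]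
      chain_profile_block[of 1 4 5 cubic_weight c t] chain_profile_block[of 2 4 5 cubic_weight c t]
      chain_profile_block[of 3 4 5 cubic_weight c t]
    by (simp_all add: cubic_weight_def add.commute)
  define h where "h v = (\<Sum>w | w < v \<and> cubic_chain w v. (?y v - ?y w)\<^sup>2)" for v
  have h: "h (5 + 4 * t) = (c t - c (Suc t))\<^sup>2 / 4"
    "h (6 + 4 * t) = (c t - c (Suc t))\<^sup>2 / 16"
    "h (7 + 4 * t) = (c t - c (Suc t))\<^sup>2 / 16"
    "h (8 + 4 * t) = (c t - c (Suc t))\<^sup>2 / 8"
    unfolding h_def cubic_chain_down cubic_edge_block
    by (simp_all add: y) (simp_all add: power2_eq_square field_simps)
  have "(\<Sum>j<4. h (5 + 4 * t + j)) = h (5 + 4 * t) + h (6 + 4 * t) + h (7 + 4 * t) + h (8 + 4 * t)"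
    by (simp add: eval_nat_numeral)
  also have "\<dots> = 1/2 * (c t - c (Suc t))\<^sup>2" by (simp add: h)
  finally show "(\<Sum>j<4. \<Sum>w | w < 5 + 4 * t + j \<and> cubic_chain w (5 + 4 * t + j). (?y (5 + 4 * t + j) - ?y w)\<^sup>2)
      = 1/2 * (c t - c (Suc t))\<^sup>2"
    by (simp add: h_def)
qed (auto simp: cubic_weight_def)

text \<open>The cap on 0 to 5 is K_5 with the edge between 2 and 4 subdivided by 5. Block
  \<open>t\<close> is K_4 on 6 + 5t to 9 + 5t followed by the cut vertex 10 + 5t; the first two
  vertices of K_4 are joined to the previous cut vertex, the last two to the next.\<close>

definition quartic_edge :: "nat \<Rightarrow> nat \<Rightarrow> bool" where
  "quartic_edge i j \<longleftrightarrow> i + 1 = j \<or> i + 2 = j \<and> (if j < 6 then j < 4 else (j + 4) mod 5 \<noteq> 0) \<or>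
    i + 3 = j \<and> (j < 6 \<or> (j + 4) mod 5 = 3) \<or> i = 0 \<and> j = 4"

definition quartic_chain :: "nat \<Rightarrow> nat \<Rightarrow> bool" where
  "quartic_chain i j \<longleftrightarrow> quartic_edge i j \<or> quartic_edge j i"

lemma quartic_chain_neighbours:
  "{w. quartic_chain v w} = (if v < 6 then
      [{1, 2, 3, 4}, {0, 2, 3, 4}, {0, 1, 3, 5}, {0, 1, 2, 4}, {0, 1, 3, 5}, {2, 4, 6, 7}] ! v
    else if (v + 4) mod 5 = 0 then {v - 1, v + 1, v + 2, v + 3}
    else if (v + 4) mod 5 = 3 then {v - 3, v - 2, v - 1, v + 1} else {v - 2, v - 1, v + 1, v + 2})"
proof (cases "v < 6")
  case True
  then consider "v = 0" | "v = 1" | "v = 2" | "v = 3" | "v = 4" | "v = 5" by linarith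
  then show ?thesis
    by cases (auto simp: quartic_chain_def quartic_edge_def split: if_splits)
next
  case False
  have "(v + 2 + 4) mod 5 = 0 \<longleftrightarrow> (v + 4) mod 5 = 3" "(v + 3 + 4) mod 5 = 3 \<longleftrightarrow> (v + 4) mod 5 = 0"
    by presburger+
  then have "quartic_chain v w \<longleftrightarrow> w = v + 1 \<or> w + 1 = v \<or> w = v + 2 \<and> (v + 4) mod 5 \<noteq> 3 \<or>
      w + 2 = v \<and> (v + 4) mod 5 \<noteq> 0 \<or> w = v + 3 \<and> (v + 4) mod 5 = 0 \<or> w + 3 = v \<and> (v + 4) mod 5 = 3" for w
    unfolding quartic_chain_def quartic_edge_def using False by auto
  then have "{w. quartic_chain v w} = {w. w = v + 1 \<or> w + 1 = v \<or> w = v + 2 \<and> (v + 4) mod 5 \<noteq> 3 \<or>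
      w + 2 = v \<and> (v + 4) mod 5 \<noteq> 0 \<or> w = v + 3 \<and> (v + 4) mod 5 = 0 \<or> w + 3 = v \<and> (v + 4) mod 5 = 3}"
    by (rule Collect_cong)
  also have "\<dots> = (if (v + 4) mod 5 = 0 then {v - 1, v + 1, v + 2, v + 3}
      else if (v + 4) mod 5 = 3 then {v - 3, v - 2, v - 1, v + 1} else {v - 2, v - 1, v + 1, v + 2})"
    using False by (cases "(v + 4) mod 5 = 0"; cases "(v + 4) mod 5 = 3") auto
  finally show ?thesis using False by simp
qed

lemma quartic_chain_down: "{w. w < v \<and> quartic_chain w v} = {w. quartic_edge w v}"
  by (auto simp: quartic_chain_def quartic_edge_def split: if_splits)

lemma quartic_edge_block:
  "{w. quartic_edge w (6 + 5 * t)} = {5 + 5 * t}"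
  "{w. quartic_edge w (7 + 5 * t)} = {5 + 5 * t, 6 + 5 * t}"
  "{w. quartic_edge w (8 + 5 * t)} = {6 + 5 * t, 7 + 5 * t}"
  "{w. quartic_edge w (9 + 5 * t)} = {6 + 5 * t, 7 + 5 * t, 8 + 5 * t}"
  "{w. quartic_edge w (10 + 5 * t)} = {8 + 5 * t, 9 + 5 * t}"
  by (auto simp: quartic_edge_def)

text \<open>Bundles of 2, 4 and 2 parallel edges have resistances 1/2, 1/4 and 1/2, in total 5/4,
  and so take 2/5, 1/5 and 2/5 of the drop.\<close>

definition quartic_weight :: "nat \<Rightarrow> real" where
  "quartic_weight j = (if j < 2 then 2/5 else if j < 4 then 3/5 else 1)"

interpretation quartic: block_chain quartic_chain 4 6 5 quartic_weight "4/5"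
proof
  show "quartic_chain v w \<Longrightarrow> quartic_chain w v" for v w by (auto simp: quartic_chain_def)
  show "\<not> quartic_chain v v" for v by (auto simp: quartic_chain_def quartic_edge_def)
  show "quartic_chain v (Suc v)" for v by (simp add: quartic_chain_def quartic_edge_def)
  show "quartic_chain v w \<Longrightarrow> w \<le> v + 4" for v w
    by (auto simp: quartic_chain_def quartic_edge_def split: if_splits)
  show "card {w. quartic_chain v w} = 4" for v
  proof (cases "v < 6")
    case True
    then consider "v = 0" | "v = 1" | "v = 2" | "v = 3" | "v = 4" | "v = 5" by linarith
    then show ?thesis by cases (simp_all add: quartic_chain_neighbours)
  qed (auto simp: quartic_chain_neighbours card_insert_if)
  show "0 \<le> quartic_weight j" "quartic_weight j \<le> 1" for j by (auto simp: quartic_weight_def)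
  fix c :: "nat \<Rightarrow> real"
  let ?y = "chain_profile 6 5 quartic_weight c"
  show "(\<Sum>w | w < v \<and> quartic_chain w v. (?y v - ?y w)\<^sup>2) = 0" if "v < 6" for v
    using that by (intro sum.neutral) (auto simp: chain_profile_def)
  fix t
  have y: "?y (5 + 5 * t) = c t" "?y (6 + 5 * t) = c t - 2/5 * (c t - c (Suc t))"
    "?y (7 + 5 * t) = c t - 2/5 * (c t - c (Suc t))" "?y (8 + 5 * t) = c t - 3/5 * (c t - c (Suc t))"
    "?y (9 + 5 * t) = c t - 3/5 * (c t - c (Suc t))" "?y (10 + 5 * t) = c (Suc t)"
    using chain_profile_joint[of 6 5 quartic_weight c t] chain_profile_block[of 0 5 6 quartic_weight c t]
      chain_profile_block[of 1 5 6 quartic_weight c t] chain_profile_block[of 2 5 6 quartic_weight c t]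
      chain_profile_block[of 3 5 6 quartic_weight c t] chain_profile_block[of 4 5 6 quartic_weight c t]
    by (simp_all add: quartic_weight_def add.commute)
  define h where "h v = (\<Sum>w | w < v \<and> quartic_chain w v. (?y v - ?y w)\<^sup>2)" for v
  have h: "h (6 + 5 * t) = 4 * (c t - c (Suc t))\<^sup>2 / 25"
    "h (7 + 5 * t) = 4 * (c t - c (Suc t))\<^sup>2 / 25"
    "h (8 + 5 * t) = 2 * (c t - c (Suc t))\<^sup>2 / 25"
    "h (9 + 5 * t) = 2 * (c t - c (Suc t))\<^sup>2 / 25"
    "h (10 + 5 * t) = 8 * (c t - c (Suc t))\<^sup>2 / 25"
    unfolding h_def quartic_chain_down quartic_edge_block
    by (simp_all add: y) (simp_all add: power2_eq_square field_simps)
  have "(\<Sum>j<5. h (6 + 5 * t + j)) = h (6 + 5 * t) + h (7 + 5 * t) + h (8 + 5 * t) + h (9 + 5 * t) + h (10 + 5 * t)"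
    by (simp add: eval_nat_numeral)
  also have "\<dots> = 4/5 * (c t - c (Suc t))\<^sup>2" by (simp add: h)
  finally show "(\<Sum>j<5. \<Sum>w | w < 6 + 5 * t + j \<and> quartic_chain w (6 + 5 * t + j). (?y (6 + 5 * t + j) - ?y w)\<^sup>2)
      = 4/5 * (c t - c (Suc t))\<^sup>2"
    by (simp add: h_def)
qed (auto simp: quartic_weight_def)

section \<open>The limits\<close>

text \<open>\<open>q\<close> is the number of whole blocks that fit between the cap and the last
  four vertices; \<open>x\<close> bounds it from below without rounding, so the bound is a rational
  function of \<open>n\<close>.\<close>

lemma (in block_chain) max_lambda1_lower_bound:
  fixes n :: nat and x :: real
  assumes n: "k + 4 + 3 * B \<le> n"
  defines "x \<equiv> (real n - k - 4 - B) / B"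
  shows "D - max_lambda1 n D \<le> e * pi\<^sup>2 / (4 * B * x * (x - 1))"
proof -
  define q where "q = (n - k - 4) div B"
  have Bq: "k + B * q + 4 \<le> n" 
    using n times_div_less_eq_dividend[of B "n - k - 4"] unfolding q_def by linarith
  have "3 \<le> q" using div_le_mono[of "3 * B" "n - k - 4" B] n B_pos unfolding q_def by simp
  have "n - k - 4 < B * (q + 1)"
    using B_pos unfolding q_def by (metis Suc_eq_plus1 dividend_less_times_div mult_Suc_right add.commute)
  then have "real (n - k - 4) \<le> real (B * (q + 1))" by (simp only: of_nat_le_iff)
  then have xq: "x \<le> q" using n B_pos by (simp add: x_def of_nat_diff field_simps)
  have x: "2 \<le> x"
  proof -
    have "real (k + 4 + 3 * B) \<le> real n" using n by (simp only: of_nat_le_iff)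
    then show ?thesis using B_pos by (simp add: x_def field_simps)
  qed
  have "initial_graph R n \<in> nonregular_graphs n D"
    using n B_pos by (intro initial_graph_nonregular) linarith
  then have "lambda1 (initial_graph R n) \<le> max_lambda1 n D"
    unfolding max_lambda1_def by (intro Max_ge) (auto simp: finite_nonregular_graphs)
  moreover have "D - lambda1 (initial_graph R n) \<le> e * pi\<^sup>2 / (4 * B * q * (real q - 1))"
    using \<open>3 \<le> q\<close> Bq by (intro lambda1_lower_bound) auto
  moreover have "e * pi\<^sup>2 / (4 * B * q * (real q - 1)) \<le> e * pi\<^sup>2 / (4 * B * x * (x - 1))"
    using xq x B_pos e_nonneg by (intro divide_left_mono mult_mono mult_pos_pos) auto
  ultimately show ?thesis by linarith
qed

lemma max_lambda1_attained:
  assumes "nonregular_graphs n D \<noteq> {}"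
  obtains E f N where "perron_ordered_graph n E f D (D - max_lambda1 n D) N"
proof -
  have "max_lambda1 n D \<in> lambda1 ` nonregular_graphs n D"
    unfolding max_lambda1_def using assms finite_nonregular_graphs by (intro Max_in) auto
  then obtain G where "G \<in> nonregular_graphs n D" "max_lambda1 n D = lambda1 G" by auto
  then show thesis using nonregular_graph_ordering that by metis
qed

lemma tendsto_between:
  fixes a u :: "nat \<Rightarrow> real"
  assumes lower: "\<And>\<epsilon>. 0 < \<epsilon> \<Longrightarrow> \<forall>\<^sub>F n in sequentially. K - \<epsilon> \<le> a n"
    and upper: "\<forall>\<^sub>F n in sequentially. a n \<le> u n" and u: "u \<longlonglongrightarrow> K"
  shows "a \<longlonglongrightarrow> K"
proof (rule order_tendstoI)
  fix l assume "l < K"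
  then have "\<forall>\<^sub>F n in sequentially. K - (K - l) / 2 \<le> a n" by (intro lower) simp
  then show "\<forall>\<^sub>F n in sequentially. l < a n"
    by eventually_elim (use \<open>l < K\<close> in \<open>simp add: field_simps\<close>)
next
  fix l assume "K < l"
  then have "\<forall>\<^sub>F n in sequentially. u n < l" using u by (rule order_tendstoD(2)[rotated])
  then show "\<forall>\<^sub>F n in sequentially. a n < l" using upper by eventually_elim simp
qed

lemma cubic_limit: "(\<lambda>n. (real n)\<^sup>2 * (3 - max_lambda1 n 3)) \<longlonglongrightarrow> pi\<^sup>2 / 2"
proof (rule tendsto_between)
  fix \<epsilon> :: real assume "0 < \<epsilon>"
  then obtain n\<^sub>0 where n\<^sub>0: "\<And>n E f \<mu> N. n\<^sub>0 \<le> n \<Longrightarrow> perron_ordered_graph n E f 3 \<mu> N \<Longrightarrow>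
    pi\<^sup>2 / 2 - \<epsilon> \<le> (real n)\<^sup>2 * \<mu>" using cubic_gap_lower_bound by blast
  show "\<forall>\<^sub>F n in sequentially. pi\<^sup>2 / 2 - \<epsilon> \<le> (real n)\<^sup>2 * (3 - max_lambda1 n 3)"
    using eventually_ge_at_top[of "max n\<^sub>0 5"]
  proof eventually_elim
    fix n assume n: "max n\<^sub>0 5 \<le> n"
    then have "nonregular_graphs n 3 \<noteq> {}" using cubic.initial_graph_nonregular[of n] by auto
    then obtain E f N where "perron_ordered_graph n E f 3 (real 3 - max_lambda1 n 3) N"
      by (rule max_lambda1_attained)
    then show "pi\<^sup>2 / 2 - \<epsilon> \<le> (real n)\<^sup>2 * (3 - max_lambda1 n 3)" using n\<^sub>0[of n E f] n by simp
  qed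
next
  \<comment> \<open>From k = 5 and B = 4: 13 = k + 4 + B, and 21 = k + 4 + 3 B below.\<close>
  let ?u = "\<lambda>n::nat. (real n)\<^sup>2 * (1/2 * pi\<^sup>2 / (4 * 4 * ((real n - 13) / 4) * ((real n - 13) / 4 - 1)))"
  show "\<forall>\<^sub>F n in sequentially. (real n)\<^sup>2 * (3 - max_lambda1 n 3) \<le> ?u n"
    using eventually_ge_at_top[of 21]
  proof eventually_elim
    fix n :: nat assume "21 \<le> n"
    then show "(real n)\<^sup>2 * (3 - max_lambda1 n 3) \<le> ?u n"
      using cubic.max_lambda1_lower_bound[of n] by (intro mult_left_mono) auto
  qed
  show "?u \<longlonglongrightarrow> pi\<^sup>2 / 2" by real_asymp
qed

lemma quartic_limit: "(\<lambda>n. (real n)\<^sup>2 * (4 - max_lambda1 n 4)) \<longlonglongrightarrow> pi\<^sup>2"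
proof (rule tendsto_between)
  fix \<epsilon> :: real assume "0 < \<epsilon>"
  then obtain n\<^sub>0 where n\<^sub>0: "\<And>n E f \<mu> N. n\<^sub>0 \<le> n \<Longrightarrow> perron_ordered_graph n E f 4 \<mu> N \<Longrightarrow>
    pi\<^sup>2 - \<epsilon> \<le> (real n)\<^sup>2 * \<mu>" using quartic_gap_lower_bound by blast
  show "\<forall>\<^sub>F n in sequentially. pi\<^sup>2 - \<epsilon> \<le> (real n)\<^sup>2 * (4 - max_lambda1 n 4)"
    using eventually_ge_at_top[of "max n\<^sub>0 5"]
  proof eventually_elim
    fix n assume n: "max n\<^sub>0 5 \<le> n"
    then have "nonregular_graphs n 4 \<noteq> {}" using quartic.initial_graph_nonregular[of n] by auto
    then obtain E f N where "perron_ordered_graph n E f 4 (real 4 - max_lambda1 n 4) N"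
      by (rule max_lambda1_attained)
    then show "pi\<^sup>2 - \<epsilon> \<le> (real n)\<^sup>2 * (4 - max_lambda1 n 4)" using n\<^sub>0[of n E f] n by simp
  qed
next
  \<comment> \<open>From k = 6 and B = 5: 15 = k + 4 + B, and 25 = k + 4 + 3 B below.\<close>
  let ?u = "\<lambda>n::nat. (real n)\<^sup>2 * (4/5 * pi\<^sup>2 / (4 * 5 * ((real n - 15) / 5) * ((real n - 15) / 5 - 1)))"
  show "\<forall>\<^sub>F n in sequentially. (real n)\<^sup>2 * (4 - max_lambda1 n 4) \<le> ?u n"
    using eventually_ge_at_top[of 25]
  proof eventually_elim
    fix n :: nat assume "25 \<le> n"
    then show "(real n)\<^sup>2 * (4 - max_lambda1 n 4) \<le> ?u n"
      using quartic.max_lambda1_lower_bound[of n] by (intro mult_left_mono) auto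
  qed
  show "?u \<longlonglongrightarrow> pi\<^sup>2" by real_asymp
qed

theorem theorem6p5:
  shows "((\<lambda>n. (real n)\<^sup>2 * (3 - max_lambda1 n 3)) \<longlonglongrightarrow> pi\<^sup>2 / 2) \<and>
         ((\<lambda>n. (real n)\<^sup>2 * (4 - max_lambda1 n 4)) \<longlonglongrightarrow> pi\<^sup>2)"
  using cubic_limit quartic_limit by simp

end
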